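(* $$\lim_{N\to\infty}\sqrt{\frac{N}{\log N}}\;\rho(\mathcal{B}^N_{\mathrm{hom}})=1 .$$
   Context: Here $[N]=\{1,\dots,N\}$ and $\{\pm1\}^N$ carries the normalized counting measure, $\mathbb{E}[f]=2^{-N}\sum_{x\in\{\pm1\}^N}f(x)$. Every $f\colon\{\pm1\}^N\to\mathbb{R}$ has the Fourier-Walsh expansion $f(x)=\sum_{S\subset[N]}\widehat f(S)x^S$, where $x^S=\prod_{k\in S}x_k$ (with $x^\emptyset=1$) and $\widehat f(S)=\mathbb{E}[f(x)\,x^S]$. Put $\|f\|_\infty=\max_{x}|f(x)|$. For a class $\mathcal{F}$ of functions on $\{\pm1\}^N$, its Boolean radius is $$\rho(\mathcal{F})=\sup\Big\{\rho\ge 0:\ \sum_{S\subset[N]}|\widehat f(S)|\rho^{|S|}\le\|f\|_\infty\ \text{for every } f\in\mathcal{F}\Big\}.$$ $f$ is called $d$-homogeneous if $\widehat f(S)=0$ for all $S\subset[N]$ with $|S|\ne d$, and homogeneous if it is $d$-homogeneous for some $0\le d\le N$; $\mathcal{B}^N_{\mathrm{hom}}$ denotes the class of all homogeneous functions $f\colon\{\pm1\}^N\to\mathbb{R}$. $\log$ is the natural logarithm. *)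

theory Defs
  imports "HOL-Analysis.Analysis"
begin

text \<open>
  The discrete cube is the set of extensional functions from \<open>{1..N}\<close> to \<open>{-1, 1}\<close>.
  A real function on the cube is represented by a total function on \<^typ>\<open>nat \<Rightarrow> real\<close>;
  every notion below depends only on its values on \<open>cube N\<close>.
\<close>

definition cube :: "nat \<Rightarrow> (nat \<Rightarrow> real) set" where
  "cube N = {1..N} \<rightarrow>\<^sub>E {-1, 1}"

lemma finite_cube: "finite (cube N)"
  unfolding cube_def by (intro finite_PiE) auto

lemma card_cube: "card (cube N) = 2 ^ N"
  unfolding cube_def by (simp add: card_PiE numeral_2_eq_2)

lemma cube_nonempty: "cube N \<noteq> {}"
  unfolding cube_def by (simp add: PiE_eq_empty_iff)

definition cube_expectation :: "nat \<Rightarrow> ((nat \<Rightarrow> real) \<Rightarrow> real) \<Rightarrow> real" where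
  "cube_expectation N f = (\<Sum>x\<in>cube N. f x) / 2 ^ N"

definition walsh :: "nat set \<Rightarrow> (nat \<Rightarrow> real) \<Rightarrow> real" where
  "walsh S x = (\<Prod>k\<in>S. x k)"

definition fourier_coeff :: "nat \<Rightarrow> ((nat \<Rightarrow> real) \<Rightarrow> real) \<Rightarrow> nat set \<Rightarrow> real" where
  "fourier_coeff N f S = cube_expectation N (\<lambda>x. f x * walsh S x)"

definition cube_sup_norm :: "nat \<Rightarrow> ((nat \<Rightarrow> real) \<Rightarrow> real) \<Rightarrow> real" where
  "cube_sup_norm N f = Max ((\<lambda>x. \<bar>f x\<bar>) ` cube N)"

text \<open>
  The supremum is taken in \<^typ>\<open>ereal\<close>, so that it is \<open>\<infinity>\<close> for classes that admit
  arbitrarily large radii (for instance a class consisting of constant functions only).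
\<close>

definition boolean_radius :: "nat \<Rightarrow> ((nat \<Rightarrow> real) \<Rightarrow> real) set \<Rightarrow> ereal" where
  "boolean_radius N F =
     Sup (ereal ` {\<rho>. \<rho> \<ge> 0 \<and>
       (\<forall>f\<in>F. (\<Sum>S\<in>Pow {1..N}. \<bar>fourier_coeff N f S\<bar> * \<rho> ^ card S) \<le> cube_sup_norm N f)})"

definition d_homogeneous :: "nat \<Rightarrow> nat \<Rightarrow> ((nat \<Rightarrow> real) \<Rightarrow> real) \<Rightarrow> bool" where
  "d_homogeneous N d f \<longleftrightarrow> (\<forall>S. S \<subseteq> {1..N} \<longrightarrow> card S \<noteq> d \<longrightarrow> fourier_coeff N f S = 0)"

definition homogeneous_functions :: "nat \<Rightarrow> ((nat \<Rightarrow> real) \<Rightarrow> real) set" where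
  "homogeneous_functions N = {f. \<exists>d\<le>N. d_homogeneous N d f}"

end

theory Submission
  imports Defs "HOL-Real_Asymp.Real_Asymp"
begin

text \<open>
  For \<open>d \<ge> 1\<close> let \<open>K N d\<close> be the largest ratio of \<open>\<Sum>S. \<bar>c S\<bar>\<close> to the sup norm, over the nonzero
  \<open>d\<close>-homogeneous functions with coefficients \<open>c\<close> on the \<open>N\<close>-dimensional cube. Since every coefficient is
  weighted by the same \<open>\<rho> ^ d\<close>, the Boolean radius is the minimum over \<open>d\<close> of \<open>K N d powr (- 1 / d)\<close>.
  Both bounds below come from \<open>K N d = sqrt ((N choose d) / N)\<close> up to a factor \<open>exp (o d)\<close> when \<open>d\<close> is
  comparable to \<open>ln N\<close>. With \<open>d = u * ln N\<close> the \<open>d\<close>-th root of this quantity is about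
  \<open>sqrt (N / ln N) * exp ((1 - 1 / u - ln u) / 2)\<close>, and the exponent attains its maximum \<open>0\<close>
  at \<open>u = 1\<close>. So the critical degree is \<open>ln N\<close>, and there the constant is exactly \<open>1\<close>.

  Upper bound for the radius. For a suitable choice of signs as coefficients, a homogeneous
  polynomial of degree \<open>d\<close> has sup norm at most a constant times \<open>sqrt (N * (N choose d))\<close>
  (\<open>exists_signs_small_norm\<close>): with random signs its values are subgaussian, and the cube has only
  \<open>2 ^ N\<close> points. Taking \<open>d = \<lceil>ln N\<rceil>\<close> gives \<open>eventually_bohr_radius_le\<close>.

  Lower bound for the radius. The Cauchy-Schwarz inequality alone gives
  \<open>\<Sum>S. \<bar>c S\<bar> \<le> sqrt (N choose d) * A\<close>, where \<open>A\<close> bounds the function; the missing factor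
  \<open>1 / sqrt N\<close> has to be gained at a cost of \<open>exp (\<epsilon> * d)\<close> for arbitrarily small \<open>\<epsilon>\<close>. This is done by
  a Bohnenblust-Hille argument for a fixed order \<open>k\<close>. For \<open>\<bar>T\<bar> = k\<close> let \<open>a T x\<close> be the partial
  derivative of the multilinear extension with respect to the variables in \<open>T\<close>, at \<open>x\<close>.

  \<^item> For fixed \<open>x\<close> the numbers \<open>a T x\<close> are the coefficients of a \<open>k\<close>-homogeneous function, the \<open>k\<close>-th
    directional derivative divided by \<open>k!\<close>. An inequality of Markov type bounds it by \<open>A\<close> times a power of
    \<open>d\<close> (\<open>iter_deriv_bound\<close>).
  \<^item> Blei's inequality (\<open>blei_inequality\<close>), fed with an \<open>L1\<close> bound for first order derivatives
    (\<open>sum_norm_deriv_le\<close>), then controls \<open>\<Sum>T. \<bar>a T x\<bar> powr p\<close> for \<open>p = 2 * k / (k + 1)\<close>.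
  \<^item> As \<open>p\<close> is close to \<open>2\<close>, passing from the \<open>Lp\<close> norm of \<open>a T\<close> to its \<open>L2\<close> norm costs only
    \<open>3 powr (d / k)\<close>. This follows from the elementary fourth moment bound \<open>bonami_fourth_moment\<close>,
    interpolated by \<open>moment_interpolation\<close>.
  \<^item> By the inequalities of Hoelder and Cauchy-Schwarz the sum of all \<open>\<bar>c S\<bar>\<close> is bounded through the \<open>L2\<close>
    norms of the \<open>a T\<close>, and the exponent \<open>p < 2\<close> produces the factor
    \<open>(N choose k) powr (- 1 / (2 * k))\<close>, which is at most \<open>sqrt (k / N)\<close> (\<open>coefficient_sum_le_binomial\<close>).

  All losses are powers of \<open>d\<close> apart from \<open>3 powr (d / k)\<close>, and \<open>k\<close> may be chosen as large as one likes
  before \<open>N\<close> tends to infinity. An elementary optimisation over all degrees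
  (\<open>eventually_homogeneous_estimate\<close>) completes the argument.
\<close>

section \<open>Averages and Walsh expansions on sign vectors\<close>

text \<open>
  The cube is taken over an arbitrary index set: inductions insert one index at a time, and random
  choices of coefficients are sign vectors indexed by subsets.
\<close>

definition signs :: "'a set \<Rightarrow> ('a \<Rightarrow> real) set" where
  "signs V = V \<rightarrow>\<^sub>E {-1, 1}"

definition avg :: "'a set \<Rightarrow> (('a \<Rightarrow> real) \<Rightarrow> real) \<Rightarrow> real" where
  "avg V F = (\<Sum>x\<in>signs V. F x) / 2 ^ card V"

text \<open>
  The argument is a total function, so that this is also the multilinear extension of a function on
  the cube, to be evaluated at arbitrary real vectors.
\<close>

definition walsh_sum :: "nat set \<Rightarrow> (nat set \<Rightarrow> real) \<Rightarrow> (nat \<Rightarrow> real) \<Rightarrow> real" where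
  "walsh_sum V c x = (\<Sum>S\<in>Pow V. c S * walsh S x)"

lemma finite_signs: "finite V \<Longrightarrow> finite (signs V)"
  unfolding signs_def by (intro finite_PiE) auto

lemma card_signs: "finite V \<Longrightarrow> card (signs V) = 2 ^ card V"
  unfolding signs_def by (simp add: card_PiE numeral_2_eq_2)

lemma signs_values: "x \<in> signs V \<Longrightarrow> i \<in> V \<Longrightarrow> x i = 1 \<or> x i = -1"
  unfolding signs_def by (auto dest: PiE_mem)

lemma sign_square: "x \<in> signs V \<Longrightarrow> i \<in> V \<Longrightarrow> x i * x i = 1"
  using signs_values[of x V i] by auto

lemma abs_walsh: "x \<in> signs V \<Longrightarrow> S \<subseteq> V \<Longrightarrow> \<bar>walsh S x\<bar> = 1"
  unfolding walsh_def abs_prod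
  by (intro prod.neutral) (use signs_values in fastforce)

lemma sum_signs_prod:
  fixes g :: "'a \<Rightarrow> real \<Rightarrow> 'b :: comm_semiring_1"
  assumes "finite V"
  shows "(\<Sum>x\<in>signs V. \<Prod>i\<in>V. g i (x i)) = (\<Prod>i\<in>V. g i (- 1) + g i 1)"
  using prod_sum_PiE[OF assms, of "\<lambda>_. {-1, 1::real}" g] by (simp add: signs_def)

lemma avg_mono: "(\<And>x. x \<in> signs V \<Longrightarrow> F x \<le> G x) \<Longrightarrow> avg V F \<le> avg V G"
  unfolding avg_def by (intro divide_right_mono sum_mono) auto

lemma avg_add: "avg V (\<lambda>x. F x + G x) = avg V F + avg V G"
  unfolding avg_def by (simp add: sum.distrib add_divide_distrib)

lemma avg_diff: "avg V (\<lambda>x. F x - G x) = avg V F - avg V G"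
  unfolding avg_def by (simp add: sum_subtractf diff_divide_distrib)

lemma avg_mult_left: "avg V (\<lambda>x. a * F x) = a * avg V F"
  unfolding avg_def by (simp add: sum_distrib_left)

lemma avg_sum: "avg V (\<lambda>x. \<Sum>j\<in>J. F j x) = (\<Sum>j\<in>J. avg V (F j))"
  unfolding avg_def by (simp add: sum.swap[of _ _ J] sum_divide_distrib)

lemma avg_const: "finite V \<Longrightarrow> avg V (\<lambda>x. a) = a"
  unfolding avg_def by (simp add: card_signs)

lemma avg_nonneg: "(\<And>x. x \<in> signs V \<Longrightarrow> 0 \<le> F x) \<Longrightarrow> 0 \<le> avg V F"
  unfolding avg_def by (intro divide_nonneg_pos sum_nonneg) auto

lemma walsh_alt:
  assumes "finite V" "S \<subseteq> V"
  shows "walsh S x = (\<Prod>i\<in>V. if i \<in> S then x i else 1)"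
  unfolding walsh_def using assms
  by (simp add: prod.inter_restrict[symmetric] Int_absorb1)

lemma avg_walsh_mult_walsh:
  assumes V: "finite V" and "S \<subseteq> V" "T \<subseteq> V"
  shows "avg V (\<lambda>x. walsh S x * walsh T x) = (if S = T then 1 else 0)"
proof -
  define g where "g = (\<lambda>i t::real. (if i \<in> S then t else 1) * (if i \<in> T then t else 1))"
  have "avg V (\<lambda>x. walsh S x * walsh T x) = (\<Sum>x\<in>signs V. \<Prod>i\<in>V. g i (x i)) / 2 ^ card V"
    unfolding avg_def walsh_alt[OF V assms(2)] walsh_alt[OF V assms(3)] g_def
    by (simp add: prod.distrib)
  also have "\<dots> = (\<Prod>i\<in>V. g i (- 1) + g i 1) / 2 ^ card V"
    by (simp add: sum_signs_prod[OF V])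
  also have "(\<Prod>i\<in>V. g i (- 1) + g i 1) = (\<Prod>i\<in>V. if i \<in> S \<longleftrightarrow> i \<in> T then 2 else 0)"
    by (intro prod.cong) (auto simp: g_def)
  also have "\<dots> / 2 ^ card V = (if S = T then 1 else 0)"
  proof (cases "S = T")
    case False
    then obtain i where "i \<in> V" "(i \<in> S) \<noteq> (i \<in> T)" using assms by blast
    then show ?thesis using V False by (auto simp: prod_zero_iff)
  qed simp
  finally show ?thesis .
qed

lemma avg_walsh_sum_mult_walsh:
  assumes "finite V" "T \<subseteq> V"
  shows "avg V (\<lambda>x. walsh_sum V c x * walsh T x) = c T"
proof -
  have "avg V (\<lambda>x. walsh_sum V c x * walsh T x)
      = (\<Sum>S\<in>Pow V. c S * avg V (\<lambda>x. walsh S x * walsh T x))"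
    unfolding walsh_sum_def sum_distrib_right avg_sum by (simp add: mult.assoc avg_mult_left)
  also have "\<dots> = (\<Sum>S\<in>Pow V. if S = T then c S else 0)"
    using assms by (intro sum.cong) (auto simp: avg_walsh_mult_walsh)
  finally show ?thesis using assms by simp
qed

lemma parseval:
  assumes "finite V"
  shows "avg V (\<lambda>x. (walsh_sum V c x)\<^sup>2) = (\<Sum>S\<in>Pow V. (c S)\<^sup>2)"
proof -
  have "avg V (\<lambda>x. (walsh_sum V c x)\<^sup>2)
      = avg V (\<lambda>x. \<Sum>S\<in>Pow V. c S * (walsh_sum V c x * walsh S x))"
    unfolding power2_eq_square by (subst (2) walsh_sum_def) (simp add: sum_distrib_left mult_ac)
  also have "\<dots> = (\<Sum>S\<in>Pow V. c S * c S)"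
    unfolding avg_sum avg_mult_left using assms
    by (intro sum.cong) (auto simp: avg_walsh_sum_mult_walsh)
  finally show ?thesis by (simp add: power2_eq_square)
qed

text \<open>
  Summing the characters first turns the expansion into averaging against the kernel
  \<open>\<Prod>i\<in>V. 1 + z i * y i\<close>. On the cube this kernel is concentrated at \<open>y = z\<close>, which gives the inversion
  formula; for \<open>z\<close> in the solid cube it is a probability density, which gives the maximum principle.
\<close>

lemma walsh_sum_fourier:
  assumes "finite V"
  shows "walsh_sum V (\<lambda>S. avg V (\<lambda>x. f x * walsh S x)) z
       = avg V (\<lambda>y. f y * (\<Prod>i\<in>V. 1 + z i * y i))"
proof -
  have "(\<Prod>i\<in>V. 1 + z i * y i) = (\<Sum>S\<in>Pow V. walsh S z * walsh S y)" for y :: "nat \<Rightarrow> real"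
    using prod_add[OF assms, of "\<lambda>i. z i * y i" "\<lambda>_. 1"]
    by (simp add: walsh_def prod.distrib add.commute)
  then show ?thesis
    unfolding walsh_sum_def
    by (simp add: sum_distrib_left avg_sum mult_ac flip: avg_mult_left)
qed

lemma fourier_inversion:
  assumes V: "finite V" and z: "z \<in> signs V"
  shows "walsh_sum V (\<lambda>S. avg V (\<lambda>x. f x * walsh S x)) z = f z"
proof -
  have "(\<Prod>i\<in>V. 1 + z i * y i) = (if y = z then 2 ^ card V else 0)" if y: "y \<in> signs V" for y
  proof (cases "y = z")
    case True
    then show ?thesis using sign_square[OF z] by simp
  next
    case False
    then obtain i where "i \<in> V" "y i \<noteq> z i"
      using y z unfolding signs_def by (meson PiE_ext)
    moreover from this have "1 + z i * y i = 0"
      using signs_values[OF y] signs_values[OF z] by fastforce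
    ultimately show ?thesis using V False by auto
  qed
  then have "(\<Sum>y\<in>signs V. f y * (\<Prod>i\<in>V. 1 + z i * y i)) = (\<Sum>y\<in>signs V. if y = z then f y * 2 ^ card V else 0)"
    by (intro sum.cong) auto
  then show ?thesis
    unfolding walsh_sum_fourier[OF V] by (simp add: avg_def z finite_signs[OF V])
qed

lemma walsh_sum_bound_solid_cube:
  assumes V: "finite V" and bound: "\<And>x. x \<in> signs V \<Longrightarrow> \<bar>walsh_sum V c x\<bar> \<le> A"
    and z: "\<And>i. i \<in> V \<Longrightarrow> \<bar>z i\<bar> \<le> 1"
  shows "\<bar>walsh_sum V c z\<bar> \<le> A"
proof -
  let ?K = "\<lambda>y. \<Prod>i\<in>V. 1 + z i * y i"
  have K: "?K y \<ge> 0" if "y \<in> signs V" for y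
    using signs_values[OF that] z by (intro prod_nonneg) fastforce
  \<comment> \<open>The kernel is a probability density on the cube.\<close>
  have K1: "avg V ?K = 1"
    unfolding avg_def using sum_signs_prod[OF V, of "\<lambda>i t. 1 + z i * t"] by simp
  have "walsh_sum V c z = walsh_sum V (\<lambda>S. avg V (\<lambda>x. walsh_sum V c x * walsh S x)) z"
    unfolding walsh_sum_def[of V _ z] using V
    by (intro sum.cong) (simp_all add: avg_walsh_sum_mult_walsh)
  then have *: "walsh_sum V c z = avg V (\<lambda>y. walsh_sum V c y * ?K y)"
    by (simp add: walsh_sum_fourier[OF V])
  have "avg V (\<lambda>y. walsh_sum V c y * ?K y) \<le> avg V (\<lambda>y. A * ?K y)"
    using bound K by (intro avg_mono mult_right_mono) (force simp: abs_le_iff)+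
  moreover have "avg V (\<lambda>y. (- A) * ?K y) \<le> avg V (\<lambda>y. walsh_sum V c y * ?K y)"
    using bound K by (intro avg_mono mult_right_mono) (force simp: abs_le_iff)+
  ultimately show ?thesis
    unfolding * avg_mult_left K1 by simp
qed

section \<open>The fourth moment inequality\<close>

lemma avg_insert:
  assumes "finite V" "n \<notin> V"
  shows "avg (insert n V) F = avg V (\<lambda>x. (F (x(n := -1)) + F (x(n := 1))) / 2)"
proof -
  have "(\<Sum>x\<in>signs (insert n V). F x) = (\<Sum>(t, x)\<in>{-1, 1} \<times> signs V. F (x(n := t)))"
    unfolding signs_def PiE_insert_eq
    by (subst sum.reindex[OF inj_combinator[OF assms(2)]]) (simp add: case_prod_unfold)
  also have "\<dots> = (\<Sum>x\<in>signs V. F (x(n := -1))) + (\<Sum>x\<in>signs V. F (x(n := 1)))"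
    by (simp flip: sum.cartesian_product)
  finally show ?thesis
    using assms unfolding avg_def by (simp add: sum.distrib flip: sum_divide_distrib)
qed

lemma walsh_sum_insert:
  assumes "finite V" "n \<notin> V"
  shows "walsh_sum (insert n V) c (x(n := t)) = walsh_sum V c x + t * walsh_sum V (\<lambda>S. c (insert n S)) x"
proof -
  have 1: "walsh S (x(n := t)) = walsh S x" if "S \<subseteq> V" for S
    unfolding walsh_def using assms(2) that by (intro prod.cong) auto
  have 2: "walsh (insert n S) (x(n := t)) = t * walsh S x" if "S \<subseteq> V" for S
    using 1[OF that] assms that finite_subset[OF that]
    by (subst walsh_def, subst prod.insert) (auto simp: walsh_def)
  have inj: "inj_on (insert n) (Pow V)"
    using assms(2) by (auto simp: inj_on_def)
  have "walsh_sum (insert n V) c (x(n := t))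
      = (\<Sum>S\<in>Pow V. c S * walsh S (x(n := t))) + (\<Sum>S\<in>insert n ` Pow V. c S * walsh S (x(n := t)))"
    unfolding walsh_sum_def Pow_insert using assms by (intro sum.union_disjoint) auto
  also have "\<dots> = (\<Sum>S\<in>Pow V. c S * walsh S x) + (\<Sum>S\<in>Pow V. c (insert n S) * (t * walsh S x))"
    unfolding sum.reindex[OF inj] o_def by (intro arg_cong2[of _ _ _ _ "(+)"] sum.cong) (auto simp: 1 2)
  finally show ?thesis by (simp add: walsh_sum_def sum_distrib_left mult_ac)
qed

lemma avg_cauchy_schwarz:
  "(avg V (\<lambda>x. F x * G x))\<^sup>2 \<le> avg V (\<lambda>x. (F x)\<^sup>2) * avg V (\<lambda>x. (G x)\<^sup>2)"
proof -
  have "(avg V (\<lambda>x. F x * G x))\<^sup>2 = (\<Sum>x\<in>signs V. F x * G x)\<^sup>2 / (2 ^ card V)\<^sup>2"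
    by (simp add: avg_def power_divide)
  also have "\<dots> \<le> ((\<Sum>x\<in>signs V. (F x)\<^sup>2) * (\<Sum>x\<in>signs V. (G x)\<^sup>2)) / (2 ^ card V)\<^sup>2"
    by (intro divide_right_mono Cauchy_Schwarz_ineq_sum) simp
  finally show ?thesis by (simp add: avg_def power2_eq_square)
qed

text \<open>
  Splitting off one variable writes the polynomial as \<open>u + t * v\<close> with a sign \<open>t\<close>, where \<open>v\<close> has degree
  at most \<open>d - 1\<close>. Averaging over \<open>t\<close> leaves only the even terms \<open>u ^ 4 + 6 * u\<^sup>2 * v\<^sup>2 + v ^ 4\<close>. By the
  Cauchy-Schwarz inequality the smaller degree of \<open>v\<close> saves a factor \<open>3\<close> in the mixed term, so its
  coefficient \<open>6\<close> becomes the \<open>2\<close> of the binomial formula. Hence the base \<open>9 = 3\<^sup>2\<close>.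
\<close>

lemma bonami_fourth_moment:
  assumes "finite V" and "\<And>S. S \<subseteq> V \<Longrightarrow> d < card S \<Longrightarrow> c S = 0"
  shows "avg V (\<lambda>x. (walsh_sum V c x) ^ 4) \<le> 9 ^ d * (avg V (\<lambda>x. (walsh_sum V c x)\<^sup>2))\<^sup>2"
  using assms
proof (induction V arbitrary: c d rule: finite_induct)
  case empty
  have "1 * (c {}) ^ 4 \<le> 9 ^ d * (c {}) ^ 4"
    by (intro mult_right_mono) auto
  then show ?case by (simp add: walsh_sum_def walsh_def avg_const)
next
  case (insert n V)
  let ?u = "walsh_sum V c" and ?v = "walsh_sum V (\<lambda>S. c (insert n S))"
  let ?h = "walsh_sum (insert n V) c"
  define U where "U = avg V (\<lambda>x. (?u x)\<^sup>2)"
  define W where "W = avg V (\<lambda>x. (?v x)\<^sup>2)"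
  have UW: "0 \<le> U" "0 \<le> W" unfolding U_def W_def by (auto intro: avg_nonneg)
  have h2: "avg (insert n V) (\<lambda>x. (?h x)\<^sup>2) = U + W"
  proof -
    have "((a + -1 * b)\<^sup>2 + (a + 1 * b)\<^sup>2) / 2 = a\<^sup>2 + b\<^sup>2" for a b :: real
      by (simp add: power2_eq_square algebra_simps)
    then show ?thesis
      unfolding avg_insert[OF insert.hyps(1,2)] walsh_sum_insert[OF insert.hyps(1,2)] U_def W_def
      by (simp only: avg_add)
  qed
  have h4: "avg (insert n V) (\<lambda>x. (?h x) ^ 4)
      = avg V (\<lambda>x. (?u x) ^ 4) + 6 * avg V (\<lambda>x. (?u x)\<^sup>2 * (?v x)\<^sup>2) + avg V (\<lambda>x. (?v x) ^ 4)"
  proof -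
    have "((a + -1 * b) ^ 4 + (a + 1 * b) ^ 4) / 2 = a ^ 4 + 6 * (a\<^sup>2 * b\<^sup>2) + b ^ 4" for a b :: real
      by (simp add: power2_eq_square power4_eq_xxxx algebra_simps)
    then show ?thesis
      unfolding avg_insert[OF insert.hyps(1,2)] walsh_sum_insert[OF insert.hyps(1,2)]
      by (simp only: avg_add avg_mult_left)
  qed
  have u4: "avg V (\<lambda>x. (?u x) ^ 4) \<le> 9 ^ d * U\<^sup>2"
    unfolding U_def by (intro insert.IH insert.prems) auto
  show ?case
  proof (cases d)
    case 0
    have "c (insert n S) = 0" if "S \<subseteq> V" for S
      using that insert.hyps finite_subset[OF that] 0 by (intro insert.prems) (auto simp: card_gt_0_iff)
    then have v0: "?v x = 0" for x by (simp add: walsh_sum_def)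
    then have "W = 0" by (simp add: W_def avg_const insert.hyps)
    then show ?thesis using u4 by (simp add: h4 h2 v0 avg_const insert.hyps)
  next
    case (Suc e)
    have v4: "avg V (\<lambda>x. (?v x) ^ 4) \<le> 9 ^ e * W\<^sup>2"
      unfolding W_def
    proof (intro insert.IH)
      fix S assume "S \<subseteq> V" "e < card S"
      then show "c (insert n S) = 0" using insert.hyps Suc finite_subset[of S V]
        by (intro insert.prems) (auto simp: card_insert_if)
    qed
    have "(avg V (\<lambda>x. (?u x)\<^sup>2 * (?v x)\<^sup>2))\<^sup>2 \<le> avg V (\<lambda>x. (?u x) ^ 4) * avg V (\<lambda>x. (?v x) ^ 4)"
      using avg_cauchy_schwarz[of V "\<lambda>x. (?u x)\<^sup>2" "\<lambda>x. (?v x)\<^sup>2"] by (simp flip: power_mult)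
    also have "\<dots> \<le> (9 ^ d * U\<^sup>2) * (9 ^ e * W\<^sup>2)"
      using u4 v4 by (intro mult_mono) (auto intro: avg_nonneg)
    also have "\<dots> = (3 * 9 ^ e * U * W)\<^sup>2"
      by (simp add: Suc power2_eq_square)
    finally have uv: "avg V (\<lambda>x. (?u x)\<^sup>2 * (?v x)\<^sup>2) \<le> 3 * 9 ^ e * U * W"
      by (rule power2_le_imp_le) (simp add: UW)
    have "avg (insert n V) (\<lambda>x. (?h x) ^ 4) \<le> 9 ^ d * U\<^sup>2 + 6 * (3 * 9 ^ e * U * W) + 9 ^ e * W\<^sup>2"
      unfolding h4 using u4 uv v4 by linarith
    also have "\<dots> \<le> 9 ^ d * U\<^sup>2 + 6 * (3 * 9 ^ e * U * W) + 9 ^ d * W\<^sup>2"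
      by (intro add_left_mono mult_right_mono) (auto simp: Suc)
    also have "\<dots> = 9 ^ d * (U + W)\<^sup>2"
      by (simp add: Suc power2_eq_square algebra_simps)
    finally show ?thesis by (simp add: h2)
  qed
qed

section \<open>Elementary inequalities\<close>

definition slice :: "'a set \<Rightarrow> nat \<Rightarrow> 'a set set" where
  "slice V k = {T. T \<subseteq> V \<and> card T = k}"

lemma finite_slice: "finite V \<Longrightarrow> finite (slice V k)"
  unfolding slice_def by simp

lemma card_slice: "finite V \<Longrightarrow> card (slice V k) = card V choose k"
  unfolding slice_def by (simp add: n_subsets)

lemma powr_minus_ge_tangent:
  fixes v \<beta> :: real
  assumes "0 < v" "0 \<le> \<beta>"
  shows "1 - \<beta> * (v - 1) \<le> v powr (- \<beta>)"
proof -
  have "1 - \<beta> * (v - 1) \<le> 1 + (- \<beta> * ln v)"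
    using mult_left_mono[OF ln_le_minus_one[OF assms(1)] assms(2)] by simp
  also have "\<dots> \<le> exp (- \<beta> * ln v)" by (rule exp_ge_add_one_self)
  finally show ?thesis using assms by (simp add: powr_def)
qed

text \<open>
  This is the substitute for general hypercontractivity: a second moment bound for \<open>s\<close> forces the
  moment of order \<open>r < 1\<close> to be large, with a constant tending to \<open>1\<close> as \<open>r\<close> tends to \<open>1\<close>. The function
  \<open>v powr (r - 1)\<close> is convex, so it lies above its tangent; the tangent is taken at the largest value
  \<open>m = Q * avg V s\<close> that the mean of \<open>s\<close> under the density proportional to \<open>s\<close> can have. It will be
  applied to the square of a polynomial.
\<close>

lemma moment_interpolation:
  assumes s: "\<And>x. x \<in> signs V \<Longrightarrow> 0 \<le> s x" and Q: "0 < Q" and r: "0 < r" "r \<le> 1"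
    and second: "avg V (\<lambda>x. (s x)\<^sup>2) \<le> Q * (avg V s)\<^sup>2"
  shows "(avg V s) powr r \<le> Q powr (1 - r) * avg V (\<lambda>x. s x powr r)"
proof (cases "avg V s = 0")
  case True
  then show ?thesis by (auto intro!: mult_nonneg_nonneg avg_nonneg)
next
  case False
  define \<sigma> where "\<sigma> = avg V s"
  have \<sigma>: "\<sigma> > 0" using False avg_nonneg[of V s] s by (simp add: \<sigma>_def less_le)
  define m where "m = Q * \<sigma>"
  define \<beta> where "\<beta> = 1 - r"
  have m: "m > 0" using \<sigma> Q by (simp add: m_def)
  have \<beta>: "\<beta> \<ge> 0" using r by (simp add: \<beta>_def)
  have pointwise: "m powr (- \<beta>) * ((1 + \<beta>) * s x - \<beta> / m * (s x)\<^sup>2) \<le> s x powr r"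
    if "x \<in> signs V" for x
  proof (cases "s x = 0")
    case False
    then have sx: "s x > 0" using s[OF that] by simp
    have "m powr (- \<beta>) * ((1 + \<beta>) * s x - \<beta> / m * (s x)\<^sup>2)
        = m powr (- \<beta>) * (s x * (1 - \<beta> * (s x / m - 1)))"
      using m by (simp add: field_simps power2_eq_square)
    also have "\<dots> \<le> m powr (- \<beta>) * (s x * (s x / m) powr (- \<beta>))"
      using sx m \<beta> by (intro mult_left_mono powr_minus_ge_tangent) auto
    also have "\<dots> = s x powr 1 * s x powr (- \<beta>)"
      using sx m by (simp add: powr_divide)
    also have "\<dots> = s x powr r" unfolding powr_add[symmetric] by (simp add: \<beta>_def)
    finally show ?thesis .
  qed simp
  have "\<sigma> powr r = Q powr (1 - r) * (m powr (- \<beta>) * \<sigma>)"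
  proof -
    have "\<sigma> powr (r - 1) * \<sigma> = \<sigma> powr (r - 1) * \<sigma> powr 1" using \<sigma> by simp
    also have "\<dots> = \<sigma> powr r" unfolding powr_add[symmetric] by simp
    finally show ?thesis
      using \<sigma> Q powr_add[of Q "1 - r" "r - 1"] by (simp add: m_def \<beta>_def powr_mult mult.assoc[symmetric])
  qed
  also have "\<dots> \<le> Q powr (1 - r) * (m powr (- \<beta>) * ((1 + \<beta>) * \<sigma> - \<beta> / m * avg V (\<lambda>x. (s x)\<^sup>2)))"
  proof (intro mult_left_mono)
    have "\<beta> / m * avg V (\<lambda>x. (s x)\<^sup>2) \<le> \<beta> / m * (Q * \<sigma>\<^sup>2)"
      using second m \<beta> by (intro mult_left_mono) (auto simp: \<sigma>_def)
    also have "\<dots> = \<beta> * \<sigma>" using \<sigma> Q by (simp add: m_def power2_eq_square)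
    finally show "\<sigma> \<le> (1 + \<beta>) * \<sigma> - \<beta> / m * avg V (\<lambda>x. (s x)\<^sup>2)"
      by (simp add: algebra_simps)
  qed auto
  also have "\<dots> = Q powr (1 - r) * avg V (\<lambda>x. m powr (- \<beta>) * ((1 + \<beta>) * s x - \<beta> / m * (s x)\<^sup>2))"
    by (simp only: avg_mult_left avg_diff \<sigma>_def)
  also have "\<dots> \<le> Q powr (1 - r) * avg V (\<lambda>x. s x powr r)"
    using pointwise by (intro mult_left_mono avg_mono) auto
  finally show ?thesis by (simp add: \<sigma>_def)
qed

text \<open>
  Jensen's inequality for the concave function \<open>v powr q\<close>.
\<close>

lemma sum_powr_le_card_powr:
  fixes X :: "'a \<Rightarrow> real"
  assumes J: "finite J" and X: "\<And>j. j \<in> J \<Longrightarrow> 0 \<le> X j" and q: "0 < q" "q \<le> 1"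
  shows "(\<Sum>j\<in>J. X j powr q) \<le> real (card J) powr (1 - q) * (\<Sum>j\<in>J. X j) powr q"
proof (cases "(\<Sum>j\<in>J. X j) = 0")
  case True
  then show ?thesis using X J by (simp add: sum_nonneg_eq_0_iff)
next
  case False
  define n where "n = real (card J)"
  define m where "m = (\<Sum>j\<in>J. X j) / n"
  have n: "n > 0" using False J by (auto simp: n_def card_gt_0_iff)
  have sum_pos: "(\<Sum>j\<in>J. X j) > 0" using False X by (simp add: less_le sum_nonneg)
  then have m: "m > 0" using n by (simp add: m_def)
  have "X j powr q \<le> m powr q * (q * (X j / m) + (1 - q))" if "j \<in> J" for j
  proof (cases "X j = 0")
    case False
    then have "X j > 0" using X[OF that] by simp
    then have "(X j / m) powr q * 1 powr (1 - q) \<le> q * (X j / m) + (1 - q) * 1"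
      using m q by (intro Youngs_inequality_0) auto
    then have "m powr q * ((X j / m) powr q) \<le> m powr q * (q * (X j / m) + (1 - q))"
      by (intro mult_left_mono) auto
    then show ?thesis using \<open>X j > 0\<close> m by (simp add: powr_divide)
  qed (use q in simp)
  then have "(\<Sum>j\<in>J. X j powr q) \<le> (\<Sum>j\<in>J. m powr q * (q * (X j / m) + (1 - q)))"
    by (rule sum_mono)
  also have "\<dots> = m powr q * (q * ((\<Sum>j\<in>J. X j) / m) + (1 - q) * n)"
    by (simp add: sum.distrib sum_distrib_left sum_divide_distrib n_def distrib_left mult_ac)
  also have "(\<Sum>j\<in>J. X j) / m = n" using m n sum_pos by (simp add: m_def)
  also have "m powr q * (q * n + (1 - q) * n) = n powr 1 * m powr q"
    using n by (simp add: algebra_simps)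
  also have "\<dots> = n powr (1 - q) * (\<Sum>j\<in>J. X j) powr q"
    using n sum_pos by (simp add: m_def powr_divide powr_diff)
  finally show ?thesis by (simp add: n_def)
qed

text \<open>
  Write \<open>a = \<alpha> T\<close>. The \<open>k + 1\<close> numbers \<open>a / F i\<close> for \<open>i \<in> T\<close> and \<open>\<Prod>i\<in>T. F i\<close> have the product \<open>a ^ k\<close>, so
  their geometric mean is the power of \<open>a\<close> to be summed, and it is at most their arithmetic mean. Both
  kinds of terms can be summed over \<open>T\<close>: summing \<open>\<alpha> T / F i\<close> over the \<open>T\<close> that contain \<open>i\<close> gives \<open>F i\<close>
  by definition, and the products are terms in the expansion of \<open>\<Prod>i\<in>V. 1 + F i\<close>.
\<close>

lemma blei_normalised:
  fixes V :: "'a set" and \<alpha> :: "'a set \<Rightarrow> real" and F :: "'a \<Rightarrow> real"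
  assumes V: "finite V" and k: "k \<ge> 1" and \<alpha>: "\<And>T. 0 \<le> \<alpha> T"
    and F: "\<And>i. F i = sqrt (\<Sum>T | T \<in> slice V k \<and> i \<in> T. \<alpha> T)"
    and one: "(\<Sum>i\<in>V. F i) \<le> 1"
  shows "(\<Sum>T\<in>slice V k. \<alpha> T powr (real k / real (k + 1))) \<le> 2"
proof -
  have F0: "F i \<ge> 0" for i unfolding F using \<alpha> by (simp add: sum_nonneg)
  have pt: "\<alpha> T powr (real k / real (k + 1)) \<le> ((\<Sum>i\<in>T. \<alpha> T / F i) + (\<Prod>i\<in>T. F i)) / (k + 1)"
    if T: "T \<in> slice V k" for T
  proof (cases "\<alpha> T = 0")
    case True
    then show ?thesis using F0 by (auto intro!: divide_nonneg_pos prod_nonneg)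
  next
    case False
    then have a: "\<alpha> T > 0" using \<alpha>[of T] by simp
    have fT: "finite T" and cT: "card T = k" using T V finite_subset by (auto simp: slice_def)
    have Fpos: "F i > 0" if "i \<in> T" for i
      unfolding F using that T a \<alpha> finite_slice[OF V, of k]
      by (auto intro!: sum_pos2[of _ T])
    \<comment> \<open>The extra index \<open>None\<close> carries the product of all \<open>F i\<close>.\<close>
    define x where "x = (\<lambda>j. case j of None \<Rightarrow> (\<Prod>i\<in>T. F i) | Some i \<Rightarrow> \<alpha> T / F i)"
    let ?S = "insert None (Some ` T)"
    have cS: "card ?S = k + 1" using fT cT by (subst card_insert_disjoint) (auto simp: card_image)
    have "(\<Prod>j\<in>?S. x j) powr (1 / card ?S) \<le> (\<Sum>j\<in>?S. x j / card ?S)"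
      using F0 \<alpha> fT by (intro arith_geom_mean) (auto simp: x_def intro!: prod_nonneg)
    also have "(\<Prod>j\<in>?S. x j) = (\<Prod>i\<in>T. F i) * (\<Prod>i\<in>T. \<alpha> T / F i)"
      using fT by (subst prod.insert) (auto simp: x_def prod.reindex)
    also have "\<dots> = (\<Prod>i\<in>T. F i * (\<alpha> T / F i))" by (rule prod.distrib[symmetric])
    also have "\<dots> = (\<Prod>i\<in>T. \<alpha> T)" using Fpos by (intro prod.cong) force+
    also have "\<dots> = \<alpha> T powr k" using cT a by (simp add: powr_realpow)
    also have "(\<alpha> T powr k) powr (1 / card ?S) = \<alpha> T powr (real k / real (k + 1))"
      unfolding cS by (simp add: powr_powr)
    also have "(\<Sum>j\<in>?S. x j / card ?S) = (\<Sum>j\<in>?S. x j) / (k + 1)"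
      unfolding cS by (simp add: sum_divide_distrib)
    also have "(\<Sum>j\<in>?S. x j) = (\<Sum>i\<in>T. \<alpha> T / F i) + (\<Prod>i\<in>T. F i)"
      using fT by (subst sum.insert) (auto simp: x_def sum.reindex)
    finally show ?thesis .
  qed
  have "(\<Sum>T\<in>slice V k. \<Sum>i\<in>T. \<alpha> T / F i) = (\<Sum>T\<in>slice V k. \<Sum>i | i \<in> V \<and> i \<in> T. \<alpha> T / F i)"
    by (intro sum.cong) (auto simp: slice_def)
  also have "\<dots> = (\<Sum>i\<in>V. \<Sum>T | T \<in> slice V k \<and> i \<in> T. \<alpha> T / F i)"
    by (rule sum.swap_restrict[OF finite_slice[OF V] V])
  also have "\<dots> = (\<Sum>i\<in>V. (F i)\<^sup>2 / F i)"
    using \<alpha> by (simp add: F sum_nonneg sum_divide_distrib)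
  also have "\<dots> = (\<Sum>i\<in>V. F i)" by (simp add: power2_eq_square)
  finally have s1: "(\<Sum>T\<in>slice V k. \<Sum>i\<in>T. \<alpha> T / F i) \<le> 1" using one by simp
  have "(\<Sum>T\<in>slice V k. \<Prod>i\<in>T. F i) \<le> (\<Sum>T\<in>Pow V. \<Prod>i\<in>T. F i)"
    using V F0 by (intro sum_mono2) (auto simp: slice_def intro!: prod_nonneg)
  also have "\<dots> = (\<Prod>i\<in>V. F i + 1)" using prod_add[OF V, of F "\<lambda>_. 1"] by simp
  also have "\<dots> \<le> (\<Prod>i\<in>V. exp (F i))"
    using F0 by (intro prod_mono) (auto simp: add.commute)
  also have "\<dots> = exp (\<Sum>i\<in>V. F i)" using V by (simp add: exp_sum)
  also have "\<dots> \<le> exp 1" using one by simp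
  also have "\<dots> \<le> 3" by (rule exp_le)
  finally have s2: "(\<Sum>T\<in>slice V k. \<Prod>i\<in>T. F i) \<le> 3" .
  have "(\<Sum>T\<in>slice V k. \<alpha> T powr (real k / real (k + 1)))
      \<le> (\<Sum>T\<in>slice V k. ((\<Sum>i\<in>T. \<alpha> T / F i) + (\<Prod>i\<in>T. F i)) / (k + 1))"
    by (rule sum_mono) (rule pt)
  also have "\<dots> = ((\<Sum>T\<in>slice V k. \<Sum>i\<in>T. \<alpha> T / F i) + (\<Sum>T\<in>slice V k. \<Prod>i\<in>T. F i)) / (k + 1)"
    by (simp only: sum_divide_distrib[symmetric] sum.distrib)
  also have "\<dots> \<le> 4 / (k + 1)" using s1 s2 by (intro divide_right_mono) auto
  also have "\<dots> \<le> 4 / 2" using k by (intro divide_left_mono) auto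
  also have "4 / 2 = (2 :: real)" by simp
  finally show ?thesis .
qed

text \<open>
  The case of a general bound \<open>M\<close> follows by homogeneity. The \<open>\<alpha> T\<close> are squares of coefficients, so
  this is the bound of an \<open>\<ell>\<^sub>p\<close> norm with \<open>p = 2 * k / (k + 1)\<close> by mixed \<open>(\<ell>\<^sub>1, \<ell>\<^sub>2)\<close> norms.
\<close>

lemma blei_inequality:
  fixes V :: "'a set" and \<alpha> :: "'a set \<Rightarrow> real"
  assumes V: "finite V" and k: "k \<ge> 1" and \<alpha>: "\<And>T. 0 \<le> \<alpha> T"
    and bound: "(\<Sum>i\<in>V. sqrt (\<Sum>T | T \<in> slice V k \<and> i \<in> T. \<alpha> T)) \<le> M"
  shows "(\<Sum>T\<in>slice V k. \<alpha> T powr (real k / real (k + 1))) \<le> 2 * (M\<^sup>2) powr (real k / real (k + 1))"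
proof (cases "M > 0")
  case False
  have "0 \<le> (\<Sum>i\<in>V. sqrt (\<Sum>T | T \<in> slice V k \<and> i \<in> T. \<alpha> T))"
    using \<alpha> by (simp add: sum_nonneg)
  then have z: "(\<Sum>i\<in>V. sqrt (\<Sum>T | T \<in> slice V k \<and> i \<in> T. \<alpha> T)) = 0" using bound False by simp
  have "\<alpha> T = 0" if T: "T \<in> slice V k" for T
  proof -
    have "T \<noteq> {}" "T \<subseteq> V" using T k by (auto simp: slice_def)
    then obtain i where i: "i \<in> T" "i \<in> V" by blast
    have "(\<Sum>T | T \<in> slice V k \<and> i \<in> T. \<alpha> T) = 0"
      using z i V \<alpha> by (subst (asm) sum_nonneg_eq_0_iff) (auto simp: sum_nonneg)
    then show ?thesis using T i \<alpha> finite_slice[OF V, of k]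
      by (subst (asm) sum_nonneg_eq_0_iff) auto
  qed
  then show ?thesis by simp
next
  case True
  define \<alpha>' where "\<alpha>' = (\<lambda>T. \<alpha> T / M\<^sup>2)"
  have "sqrt (\<Sum>T | T \<in> slice V k \<and> i \<in> T. \<alpha>' T) = sqrt (\<Sum>T | T \<in> slice V k \<and> i \<in> T. \<alpha> T) / M" for i
    using True unfolding \<alpha>'_def by (simp add: real_sqrt_divide flip: sum_divide_distrib)
  then have "(\<Sum>i\<in>V. sqrt (\<Sum>T | T \<in> slice V k \<and> i \<in> T. \<alpha>' T)) \<le> 1"
    using bound True by (simp add: divide_le_eq flip: sum_divide_distrib)
  then have "(\<Sum>T\<in>slice V k. \<alpha>' T powr (real k / real (k + 1))) \<le> 2"
    using \<alpha> by (intro blei_normalised[OF V k, of \<alpha>' "\<lambda>i. sqrt (\<Sum>T | T \<in> slice V k \<and> i \<in> T. \<alpha>' T)"]) (auto simp: \<alpha>'_def)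
  then have "(M\<^sup>2) powr (real k / real (k + 1)) * (\<Sum>T\<in>slice V k. \<alpha>' T powr (real k / real (k + 1))) \<le> (M\<^sup>2) powr (real k / real (k + 1)) * 2"
    by (intro mult_left_mono) auto
  then show ?thesis
    using True \<alpha> by (simp add: \<alpha>'_def powr_divide sum_distrib_left mult.commute)
qed

text \<open>
  An \<open>n\<close>-th finite difference annihilates polynomials of degree less than \<open>n\<close>.
\<close>

lemma alternating_binomial_power_sum:
  fixes s :: real
  assumes "m < n"
  shows "(\<Sum>j\<le>n. (-1) ^ j * real (n choose j) * (s + real j) ^ m) = 0"
  using assms
proof (induction n arbitrary: m s)
  case (Suc n)
  let ?D = "\<lambda>m s. \<Sum>j\<le>n. (-1) ^ j * real (n choose j) * (s + real j) ^ m"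
  have "(\<Sum>j\<le>Suc n. (-1) ^ j * real (Suc n choose j) * (s + real j) ^ m) = ?D m s - ?D m (s + 1)"
  proof -
    have "(\<Sum>j\<le>Suc n. (-1) ^ j * real (Suc n choose j) * (s + real j) ^ m)
        = s ^ m + (\<Sum>j\<le>n. (-1) ^ Suc j * real (Suc n choose Suc j) * (s + real (Suc j)) ^ m)"
      by (subst sum.atMost_Suc_shift) simp
    also have "(\<Sum>j\<le>n. (-1) ^ Suc j * real (Suc n choose Suc j) * (s + real (Suc j)) ^ m)
        = (\<Sum>j\<le>n. (-1) ^ Suc j * real (n choose Suc j) * (s + real (Suc j)) ^ m) - ?D m (s + 1)"
      unfolding sum_subtractf[symmetric] by (intro sum.cong) (simp_all add: algebra_simps)
    also have "s ^ m + ((\<Sum>j\<le>n. (-1) ^ Suc j * real (n choose Suc j) * (s + real (Suc j)) ^ m) - ?D m (s + 1))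
        = (\<Sum>j\<le>Suc n. (-1) ^ j * real (n choose j) * (s + real j) ^ m) - ?D m (s + 1)"
      by (subst sum.atMost_Suc_shift) simp
    finally show ?thesis by simp
  qed
  also have "?D m (s + 1) = (\<Sum>l\<le>m. real (m choose l) * ?D l s)"
  proof -
    have "(s + 1 + real j) ^ m = (\<Sum>l\<le>m. real (m choose l) * (s + real j) ^ l)" for j
      using binomial_ring[of "s + real j" 1 m] by (simp add: algebra_simps)
    then show ?thesis
      by (simp add: sum_distrib_left mult_ac) (rule sum.swap)
  qed
  also have "\<dots> = ?D m s + (\<Sum>l<m. real (m choose l) * ?D l s)"
    by (simp add: lessThan_Suc_atMost[symmetric])
  also have "(\<Sum>l<m. real (m choose l) * ?D l s) = 0"
    using Suc by (intro sum.neutral) auto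
  finally show ?case by simp
qed simp

text \<open>
  A weak form of Markov's inequality. Substitute \<open>t = (u / d)\<^sup>2\<close> with the integers \<open>u\<close> between \<open>- d\<close> and
  \<open>d\<close>. The quotient \<open>G = (p t - b 0) / t - b 1\<close> has degree \<open>2 * d - 2\<close> in \<open>u\<close>, so the finite difference
  of order \<open>2 * d\<close> kills it. As \<open>G\<close> vanishes at \<open>u = 0\<close>, this expresses the central binomial coefficient
  times \<open>b 1\<close> by values of \<open>(p t - b 0) / t\<close> with \<open>u \<noteq> 0\<close>. The weights are at most the central
  binomial coefficient, and \<open>1 / t\<close> is at most \<open>d\<^sup>2\<close>: the grid in \<open>t\<close> is quadratically dense at \<open>0\<close>,
  which is why the loss is a power of \<open>d\<close>.
\<close>

lemma linear_coefficient_bound: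
  fixes b :: "nat \<Rightarrow> real"
  assumes d: "d \<ge> 1" and bound: "\<And>t. 0 \<le> t \<Longrightarrow> t \<le> 1 \<Longrightarrow> \<bar>\<Sum>m\<le>d. b m * t ^ m\<bar> \<le> A"
  shows "\<bar>b 1\<bar> \<le> 4 * real d ^ 3 * A"
proof -
  define p where "p t = (\<Sum>m\<le>d. b m * t ^ m)" for t
  define u where "u j = - real d + real j" for j
  define w where "w j = (-1) ^ j * real ((2 * d) choose j)" for j
  define G where "G j = (\<Sum>m=2..d. b m * (u j / d) ^ (2 * (m - 1)))" for j
  define t where "t j = (u j / d)\<^sup>2" for j
  have "(\<Sum>j\<le>2 * d. w j * G j) = (\<Sum>m=2..d. b m / d ^ (2 * (m - 1)) * (\<Sum>j\<le>2 * d. w j * u j ^ (2 * (m - 1))))"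
    unfolding G_def sum_distrib_left
    by (subst sum.swap) (simp add: power_divide mult_ac)
  also have "\<dots> = 0"
    unfolding w_def u_def by (intro sum.neutral ballI) (subst alternating_binomial_power_sum, auto)
  finally have wG: "(\<Sum>j\<le>2 * d. w j * G j) = 0" .
  have w0: "(\<Sum>j\<le>2 * d. w j) = 0"
    using alternating_binomial_power_sum[of 0 "2 * d" 0] d by (simp add: w_def)
  have p0: "p 0 = b 0" unfolding p_def by (subst sum.remove[of _ 0]) (auto simp: power_0_left)
  have pG: "p (t j) - b 0 = t j * (b 1 + G j)" for j
  proof -
    have "{..d} = insert 0 (insert 1 {2..d})" using d by auto
    then have "p (t j) = b 0 + b 1 * t j + (\<Sum>m=2..d. b m * t j ^ m)"
      unfolding p_def by simp
    also have "(\<Sum>m=2..d. b m * t j ^ m) = t j * G j"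
      unfolding G_def sum_distrib_left
    proof (intro sum.cong refl)
      fix m assume "m \<in> {2..d}"
      then have "t j ^ m = t j * t j ^ (m - 1)" by (cases m) auto
      then show "b m * t j ^ m = t j * (b m * (u j / d) ^ (2 * (m - 1)))"
        by (simp add: t_def power_mult)
    qed
    finally show ?thesis by (simp add: algebra_simps)
  qed
  have Gd: "G d = 0" unfolding G_def u_def by (intro sum.neutral) auto
  have A: "A \<ge> 0" using bound[of 0] by linarith
  have summand: "\<bar>w j * (b 1 + G j)\<bar> \<le> real ((2 * d) choose d) * (2 * A * d\<^sup>2)"
    if "j \<in> {..2 * d} - {d}" for j
  proof -
    have u1: "1 \<le> \<bar>u j\<bar>" "\<bar>u j\<bar> \<le> d" using that by (auto simp: u_def abs_if not_less)
    have "t j \<le> 1" using u1 d unfolding t_def by (simp add: abs_square_le_1)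
    have "1 \<le> (u j)\<^sup>2" using u1(1) one_le_power[of "\<bar>u j\<bar>" 2] by simp
    then have tj: "1 / d\<^sup>2 \<le> t j" by (simp add: t_def power_divide divide_right_mono)
    have tpos: "t j > 0" using tj d by (smt (verit) divide_pos_pos of_nat_0_less_iff zero_less_power less_eq_Suc_le One_nat_def)
    have "\<bar>p (t j)\<bar> \<le> A" "\<bar>b 0\<bar> \<le> A"
      using bound[of "t j"] bound[of 0] \<open>t j \<le> 1\<close> tpos p0 by (auto simp: p_def)
    then have "t j * \<bar>b 1 + G j\<bar> \<le> 2 * A"
      using abs_mult[of "t j" "b 1 + G j"] pG[of j] tpos by linarith
    moreover have "1 / d\<^sup>2 * \<bar>b 1 + G j\<bar> \<le> t j * \<bar>b 1 + G j\<bar>"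
      using tj by (intro mult_right_mono) auto
    ultimately have "1 / d\<^sup>2 * \<bar>b 1 + G j\<bar> \<le> 2 * A" by linarith
    then have "\<bar>b 1 + G j\<bar> \<le> 2 * A * d\<^sup>2"
      using d by (simp add: field_simps)
    moreover have "\<bar>w j\<bar> \<le> real ((2 * d) choose d)"
      using binomial_maximum'[of d j] by (simp add: w_def abs_mult power_abs)
    ultimately show ?thesis unfolding abs_mult by (intro mult_mono) auto
  qed
  have "(\<Sum>j\<le>2 * d. w j * (b 1 + G j)) = 0"
    using wG w0 by (simp add: distrib_left sum.distrib flip: sum_distrib_right)
  then have "w d * b 1 = - (\<Sum>j\<in>{..2 * d} - {d}. w j * (b 1 + G j))"
    by (subst (asm) sum.remove[of _ d]) (auto simp: Gd)
  then have "\<bar>w d * b 1\<bar> \<le> (\<Sum>j\<in>{..2 * d} - {d}. \<bar>w j * (b 1 + G j)\<bar>)"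
    by (simp add: sum_abs)
  also have "\<dots> \<le> (\<Sum>j\<in>{..2 * d} - {d}. real ((2 * d) choose d) * (2 * A * d\<^sup>2))"
    by (intro sum_mono summand)
  also have "\<dots> = real ((2 * d) choose d) * (4 * real d ^ 3 * A)"
    by (simp add: power3_eq_cube power2_eq_square)
  finally have "real ((2 * d) choose d) * \<bar>b 1\<bar> \<le> real ((2 * d) choose d) * (4 * real d ^ 3 * A)"
    by (simp add: w_def abs_mult power_abs)
  moreover have "real ((2 * d) choose d) > 0" by simp
  ultimately show ?thesis by (simp only: mult_le_cancel_left_pos)
qed

section \<open>Derivatives of multilinear polynomials\<close>

text \<open>
  The coefficients of the partial derivative with respect to all variables in \<open>T\<close>.
\<close>

definition deriv_coeff :: "'a set \<Rightarrow> ('a set \<Rightarrow> real) \<Rightarrow> 'a set \<Rightarrow> real" where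
  "deriv_coeff T c S = (if S \<inter> T = {} then c (S \<union> T) else 0)"

lemma deriv_coeff_empty [simp]: "deriv_coeff {} c = c"
  by (simp add: deriv_coeff_def fun_eq_iff)

text \<open>
  Summation over the coefficients of a derivative, reindexed by the coefficients \<open>c S\<close> that they come
  from. The function \<open>h\<close> allows for squares as well as for products with characters.
\<close>

lemma sum_deriv_coeff:
  assumes V: "finite V" and T: "T \<subseteq> V" and h: "\<And>S. h S 0 = (0::real)"
  shows "(\<Sum>S\<in>Pow V. h (S \<union> T) (deriv_coeff T c S)) = (\<Sum>S | S \<subseteq> V \<and> T \<subseteq> S. h S (c S))"
proof -
  have "(\<Sum>S\<in>Pow V. h (S \<union> T) (deriv_coeff T c S)) = (\<Sum>S\<in>Pow (V - T). h (S \<union> T) (c (S \<union> T)))"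
    using V by (intro sum.mono_neutral_cong_right) (auto simp: deriv_coeff_def h)
  also have "\<dots> = (\<Sum>S | S \<subseteq> V \<and> T \<subseteq> S. h S (c S))"
    using T by (intro sum.reindex_bij_witness[of _ "\<lambda>S. S - T" "\<lambda>S. S \<union> T"]) (auto simp: Un_absorb2)
  finally show ?thesis .
qed

lemma walsh_sum_taylor:
  assumes V: "finite V"
  shows "walsh_sum V c (\<lambda>i. x i + t * w i)
       = (\<Sum>T\<in>Pow V. t ^ card T * walsh T w * walsh_sum V (deriv_coeff T c) x)"
proof -
  have expand: "walsh S (\<lambda>i. x i + t * w i) = (\<Sum>T\<in>Pow S. t ^ card T * walsh T w * walsh (S - T) x)"
    if "S \<subseteq> V" for S
    using prod_add[OF finite_subset[OF that V], of "\<lambda>i. t * w i" x]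
    by (simp add: walsh_def prod.distrib add.commute)
  have "walsh_sum V c (\<lambda>i. x i + t * w i)
      = (\<Sum>S\<in>Pow V. \<Sum>T\<in>Pow S. c S * (t ^ card T * walsh T w * walsh (S - T) x))"
    unfolding walsh_sum_def by (intro sum.cong) (auto simp: expand sum_distrib_left)
  also have "\<dots> = (\<Sum>S\<in>Pow V. \<Sum>T | T \<in> Pow V \<and> T \<subseteq> S. c S * (t ^ card T * walsh T w * walsh (S - T) x))"
    by (intro sum.cong) auto
  also have "\<dots> = (\<Sum>T\<in>Pow V. \<Sum>S | S \<in> Pow V \<and> T \<subseteq> S. c S * (t ^ card T * walsh T w * walsh (S - T) x))"
    using V by (intro sum.swap_restrict) auto
  also have "\<dots> = (\<Sum>T\<in>Pow V. t ^ card T * walsh T w * walsh_sum V (deriv_coeff T c) x)"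
  proof (intro sum.cong refl)
    fix T assume T: "T \<in> Pow V"
    have "(\<Sum>S | S \<in> Pow V \<and> T \<subseteq> S. c S * (t ^ card T * walsh T w * walsh (S - T) x))
        = t ^ card T * walsh T w * (\<Sum>S | S \<subseteq> V \<and> T \<subseteq> S. c S * walsh (S - T) x)"
      by (simp add: sum_distrib_left mult_ac)
    also have "(\<Sum>S | S \<subseteq> V \<and> T \<subseteq> S. c S * walsh (S - T) x)
        = (\<Sum>S\<in>Pow V. deriv_coeff T c S * walsh ((S \<union> T) - T) x)"
      using T V by (subst sum_deriv_coeff[of V T "\<lambda>S a. a * walsh (S - T) x"]) auto
    also have "\<dots> = walsh_sum V (deriv_coeff T c) x"
      unfolding walsh_sum_def by (intro sum.cong) (auto simp: deriv_coeff_def Un_Diff Diff_triv)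
    finally show "(\<Sum>S | S \<in> Pow V \<and> T \<subseteq> S. c S * (t ^ card T * walsh T w * walsh (S - T) x))
        = t ^ card T * walsh T w * walsh_sum V (deriv_coeff T c) x" .
  qed
  finally show ?thesis .
qed

definition dir_deriv :: "'a set \<Rightarrow> ('a \<Rightarrow> real) \<Rightarrow> ('a set \<Rightarrow> real) \<Rightarrow> 'a set \<Rightarrow> real" where
  "dir_deriv V y c S = (\<Sum>i\<in>V. y i * deriv_coeff {i} c S)"

lemma walsh_sum_linear:
  "walsh_sum V (\<lambda>S. \<Sum>j\<in>J. a j * c j S) x = (\<Sum>j\<in>J. a j * walsh_sum V (c j) x)"
  unfolding walsh_sum_def sum_distrib_right sum_distrib_left
  by (subst sum.swap) (simp add: mult.assoc)

lemma walsh_sum_dir_deriv: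
  "walsh_sum V (dir_deriv V y c) x = (\<Sum>i\<in>V. y i * walsh_sum V (deriv_coeff {i} c) x)"
  unfolding dir_deriv_def by (rule walsh_sum_linear)

lemma deriv_coeff_degree:
  assumes "finite V" "T \<subseteq> V" "\<And>S. S \<subseteq> V \<Longrightarrow> d < card S \<Longrightarrow> c S = 0" "S \<subseteq> V" "d < card S + card T"
  shows "deriv_coeff T c S = 0"
proof (cases "S \<inter> T = {}")
  case True
  then have "card (S \<union> T) = card S + card T"
    using assms finite_subset by (intro card_Un_disjoint) auto
  then show ?thesis using assms by (simp add: deriv_coeff_def)
qed (simp add: deriv_coeff_def)

lemma slice_one: "slice V 1 = (\<lambda>i. {i}) ` V"
  unfolding slice_def by (auto simp: card_1_singleton_iff)

text \<open>
  Along the segment the multilinear extension is a polynomial of degree \<open>d\<close> in \<open>t\<close>, bounded by \<open>A\<close>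
  because the segment stays in the solid cube, and its linear coefficient is the directional
  derivative.
\<close>

lemma dir_deriv_bound_segment:
  assumes V: "finite V" and d: "d \<ge> 1" and deg: "\<And>S. S \<subseteq> V \<Longrightarrow> d < card S \<Longrightarrow> c S = 0"
    and bound: "\<And>x. x \<in> signs V \<Longrightarrow> \<bar>walsh_sum V c x\<bar> \<le> A"
    and segment: "\<And>t i. 0 \<le> t \<Longrightarrow> t \<le> 1 \<Longrightarrow> i \<in> V \<Longrightarrow> \<bar>x i + t * w i\<bar> \<le> 1"
  shows "\<bar>walsh_sum V (dir_deriv V w c) x\<bar> \<le> 4 * real d ^ 3 * A"
proof -
  define g where "g = (\<lambda>T. walsh T w * walsh_sum V (deriv_coeff T c) x)"
  define b where "b m = (\<Sum>T\<in>slice V m. g T)" for m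
  have eq: "walsh_sum V c (\<lambda>i. x i + t * w i) = (\<Sum>m\<le>d. b m * t ^ m)" for t
  proof -
    have "walsh_sum V c (\<lambda>i. x i + t * w i) = (\<Sum>T\<in>Pow V. t ^ card T * g T)"
      unfolding walsh_sum_taylor[OF V] g_def by (simp add: mult.assoc)
    also have "\<dots> = (\<Sum>T | T \<subseteq> V \<and> card T \<le> d. t ^ card T * g T)"
    proof (intro sum.mono_neutral_right ballI)
      fix T assume "T \<in> Pow V - {T. T \<subseteq> V \<and> card T \<le> d}"
      then have "walsh_sum V (deriv_coeff T c) x = 0"
        unfolding walsh_sum_def using V deg
        by (intro sum.neutral ballI) (subst deriv_coeff_degree[of V T d c], auto)
      then show "t ^ card T * g T = 0" by (simp add: g_def)
    qed (use V in auto)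
    also have "\<dots> = (\<Sum>m\<in>{..d}. \<Sum>T | T \<in> {T. T \<subseteq> V \<and> card T \<le> d} \<and> card T = m. t ^ card T * g T)"
      using V by (intro sum.group[symmetric]) auto
    also have "\<dots> = (\<Sum>m\<le>d. b m * t ^ m)"
      unfolding b_def sum_distrib_right
      by (intro sum.cong) (auto simp: slice_def mult.commute)
    finally show ?thesis .
  qed
  have "\<bar>b 1\<bar> \<le> 4 * real d ^ 3 * A"
  proof (rule linear_coefficient_bound[OF d])
    fix t :: real assume "0 \<le> t" "t \<le> 1"
    then show "\<bar>\<Sum>m\<le>d. b m * t ^ m\<bar> \<le> A"
      unfolding eq[symmetric] by (intro walsh_sum_bound_solid_cube[OF V bound] segment)
  qed
  also have "b 1 = walsh_sum V (dir_deriv V w c) x"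
    unfolding b_def slice_one walsh_sum_dir_deriv
    by (subst sum.reindex) (auto simp: g_def walsh_def)
  finally show ?thesis .
qed

text \<open>
  A segment starting at a vertex \<open>x\<close> in the direction \<open>y\<close> leaves the solid cube, but the segments from
  \<open>x\<close> to \<open>y\<close> and from \<open>x\<close> to \<open>- x\<close> do not, and \<open>y = (y - x) - (- 2 * x) / 2\<close>.
\<close>

lemma dir_deriv_bound:
  assumes V: "finite V" and deg: "\<And>S. S \<subseteq> V \<Longrightarrow> d < card S \<Longrightarrow> c S = 0"
    and bound: "\<And>x. x \<in> signs V \<Longrightarrow> \<bar>walsh_sum V c x\<bar> \<le> A"
    and x: "x \<in> signs V" and y: "y \<in> signs V"
  shows "\<bar>walsh_sum V (dir_deriv V y c) x\<bar> \<le> 6 * real d ^ 3 * A"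
proof (cases "d = 0")
  case True
  have "deriv_coeff {i} c S = 0" if "i \<in> V" "S \<subseteq> V" for i S
    using deriv_coeff_degree[OF V, of "{i}" 0 c S] deg that True by simp
  then have "walsh_sum V (dir_deriv V y c) x = 0"
    unfolding walsh_sum_def dir_deriv_def by (simp add: sum.neutral)
  then show ?thesis using True by simp
next
  case False
  let ?D = "\<lambda>w. walsh_sum V (dir_deriv V w c) x"
  have xi: "\<bar>x i\<bar> = 1" and yi: "\<bar>y i\<bar> = 1" if "i \<in> V" for i
    using signs_values[OF x that] signs_values[OF y that] by auto
  have "\<bar>?D (\<lambda>i. y i - x i)\<bar> \<le> 4 * real d ^ 3 * A"
  proof (rule dir_deriv_bound_segment[OF V _ deg bound])
    fix t i assume t: "0 \<le> t" "t \<le> (1::real)" and i: "i \<in> V"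
    have "x i + t * (y i - x i) = (1 - t) * x i + t * y i" by (simp add: algebra_simps)
    also have "\<bar>\<dots>\<bar> \<le> \<bar>(1 - t) * x i\<bar> + \<bar>t * y i\<bar>" by (rule abs_triangle_ineq)
    also have "\<dots> = 1" using t xi[OF i] yi[OF i] by (simp add: abs_mult)
    finally show "\<bar>x i + t * (y i - x i)\<bar> \<le> 1" .
  qed (use False in auto)
  moreover have "\<bar>?D (\<lambda>i. - 2 * x i)\<bar> \<le> 4 * real d ^ 3 * A"
  proof (rule dir_deriv_bound_segment[OF V _ deg bound])
    fix t i assume t: "0 \<le> t" "t \<le> (1::real)" and i: "i \<in> V"
    have "x i + t * (- 2 * x i) = (1 - 2 * t) * x i" by (simp add: algebra_simps)
    then show "\<bar>x i + t * (- 2 * x i)\<bar> \<le> 1" using t xi[OF i] by (simp add: abs_mult)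
  qed (use False in auto)
  moreover have "?D y = ?D (\<lambda>i. y i - x i) - 1 / 2 * ?D (\<lambda>i. - 2 * x i)"
    unfolding walsh_sum_dir_deriv sum_distrib_left sum_subtractf[symmetric]
    by (intro sum.cong) (auto simp: algebra_simps)
  ultimately show ?thesis by linarith
qed

text \<open>
  The \<open>k\<close>-th derivative in the direction \<open>y\<close>, divided by \<open>k!\<close>. As a function of \<open>y\<close> it is \<open>k\<close>-homogeneous,
  and its coefficients are the mixed derivatives of order \<open>k\<close>.
\<close>

definition iter_deriv :: "nat set \<Rightarrow> nat \<Rightarrow> (nat \<Rightarrow> real) \<Rightarrow> (nat set \<Rightarrow> real) \<Rightarrow> nat set \<Rightarrow> real" where
  "iter_deriv V k y c S = (\<Sum>T\<in>slice V k. walsh T y * deriv_coeff T c S)"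

text \<open>
  Each set \<open>U\<close> of size \<open>k + 1\<close> arises from the \<open>k + 1\<close> pairs \<open>(i, U - {i})\<close> with \<open>i \<in> U\<close>.
\<close>

lemma dir_deriv_iter_deriv:
  assumes V: "finite V"
  shows "dir_deriv V y (iter_deriv V k y c) S = (real k + 1) * iter_deriv V (Suc k) y c S"
proof -
  define h where "h = (\<lambda>U. walsh U y * deriv_coeff U c S)"
  have "dir_deriv V y (iter_deriv V k y c) S
      = (\<Sum>i\<in>V. \<Sum>T\<in>slice V k. if i \<in> T then 0 else h (insert i T))"
    unfolding dir_deriv_def
  proof (intro sum.cong refl)
    fix i assume i: "i \<in> V"
    have "walsh T y * deriv_coeff T c (insert i S) * y i = (if i \<in> T then 0 else h (insert i T))"
      if T: "T \<in> slice V k" "i \<notin> S" for T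
    proof -
      have "finite T" using T V finite_subset by (auto simp: slice_def)
      then show ?thesis using T by (auto simp: deriv_coeff_def h_def walsh_def)
    qed
    moreover have "(if i \<in> T then 0 else h (insert i T)) = 0" if "i \<in> S" for T
      using that by (auto simp: h_def deriv_coeff_def)
    ultimately show "y i * deriv_coeff {i} (iter_deriv V k y c) S
        = (\<Sum>T\<in>slice V k. if i \<in> T then 0 else h (insert i T))"
      by (cases "i \<in> S")
         (auto simp: deriv_coeff_def[of "{i}"] iter_deriv_def sum_distrib_left mult_ac intro!: sum.cong)
  qed
  also have "\<dots> = (\<Sum>i\<in>V. \<Sum>T | T \<in> slice V k \<and> i \<notin> T. h (insert i T))"
    using finite_slice[OF V, of k] by (intro sum.cong refl sum.mono_neutral_cong_right) auto
  also have "\<dots> = (\<Sum>i\<in>V. \<Sum>U | U \<in> slice V (Suc k) \<and> i \<in> U. h U)"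
  proof (rule sum.cong[OF refl])
    fix i assume i: "i \<in> V"
    have "card (insert i T) = Suc k" if "T \<subseteq> V" "card T = k" "i \<notin> T" for T
      using that finite_subset[OF _ V] by simp
    moreover have "card (U - {i}) = k" if "U \<subseteq> V" "card U = Suc k" "i \<in> U" for U
      using that finite_subset[OF _ V] by simp
    ultimately show "(\<Sum>T | T \<in> slice V k \<and> i \<notin> T. h (insert i T)) = (\<Sum>U | U \<in> slice V (Suc k) \<and> i \<in> U. h U)"
      using i by (intro sum.reindex_bij_witness[of _ "\<lambda>U. U - {i}" "insert i"]) (auto simp: slice_def)
  qed
  also have "\<dots> = (\<Sum>U\<in>slice V (Suc k). \<Sum>i | i \<in> V \<and> i \<in> U. h U)"
    by (rule sum.swap_restrict[OF V finite_slice[OF V]])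
  also have "\<dots> = (\<Sum>U\<in>slice V (Suc k). (real k + 1) * h U)"
  proof (intro sum.cong refl)
    fix U assume U: "U \<in> slice V (Suc k)"
    then have "{i. i \<in> V \<and> i \<in> U} = U" by (auto simp: slice_def)
    then show "(\<Sum>i | i \<in> V \<and> i \<in> U. h U) = (real k + 1) * h U"
      using U by (simp add: slice_def add.commute)
  qed
  finally show ?thesis by (simp add: iter_deriv_def h_def sum_distrib_left)
qed

lemma iter_deriv_bound:
  assumes V: "finite V" and deg: "\<And>S. S \<subseteq> V \<Longrightarrow> d < card S \<Longrightarrow> c S = 0"
    and bound: "\<And>x. x \<in> signs V \<Longrightarrow> \<bar>walsh_sum V c x\<bar> \<le> A"
    and y: "y \<in> signs V"
  shows "x \<in> signs V \<Longrightarrow> \<bar>walsh_sum V (iter_deriv V k y c) x\<bar> \<le> (6 * real d ^ 3) ^ k * A"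
proof (induction k arbitrary: x)
  case 0
  have "slice V 0 = {{}}" using finite_subset[OF _ V] by (auto simp: slice_def card_eq_0_iff)
  then have "iter_deriv V 0 y c = c" by (simp add: iter_deriv_def fun_eq_iff walsh_def)
  then show ?case using bound[OF 0] by simp
next
  case (Suc k)
  let ?z = "walsh_sum V (iter_deriv V (Suc k) y c) x"
  have "\<bar>walsh_sum V (dir_deriv V y (iter_deriv V k y c)) x\<bar> \<le> 6 * real d ^ 3 * ((6 * real d ^ 3) ^ k * A)"
  proof (rule dir_deriv_bound[OF V _ Suc.IH Suc.prems y])
    fix S assume "S \<subseteq> V" "d < card S"
    then show "iter_deriv V k y c S = 0"
      unfolding iter_deriv_def using deriv_coeff_degree[OF V _ deg]
      by (intro sum.neutral) (auto simp: slice_def)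
  qed
  also have "walsh_sum V (dir_deriv V y (iter_deriv V k y c)) x = (real k + 1) * ?z"
    unfolding dir_deriv_iter_deriv[OF V] walsh_sum_def by (simp add: sum_distrib_left mult.assoc)
  finally have "(real k + 1) * \<bar>?z\<bar> \<le> (6 * real d ^ 3) ^ Suc k * A"
    by (simp add: abs_mult mult.assoc)
  moreover have "1 * \<bar>?z\<bar> \<le> (real k + 1) * \<bar>?z\<bar>" by (intro mult_right_mono) auto
  ultimately show ?case by linarith
qed

text \<open>
  By the fourth moment inequality the \<open>L2\<close> norm of each derivative is at most \<open>3 ^ k\<close> times its \<open>L1\<close>
  norm. The sum of the absolute values of all derivatives at a point is a directional derivative,
  in the direction given by their signs, and hence is bounded.
\<close>

lemma sum_norm_deriv_le:
  assumes V: "finite V" and deg: "\<And>S. S \<subseteq> V \<Longrightarrow> k < card S \<Longrightarrow> a S = 0"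
    and bound: "\<And>x. x \<in> signs V \<Longrightarrow> \<bar>walsh_sum V a x\<bar> \<le> B"
  shows "(\<Sum>i\<in>V. sqrt (\<Sum>T | T \<subseteq> V \<and> i \<in> T. (a T)\<^sup>2)) \<le> 3 ^ k * (6 * real k ^ 3 * B)"
proof -
  let ?D = "\<lambda>i. walsh_sum V (deriv_coeff {i} a)"
  have norm: "sqrt (\<Sum>T | T \<subseteq> V \<and> i \<in> T. (a T)\<^sup>2) \<le> 3 ^ k * avg V (\<lambda>x. \<bar>?D i x\<bar>)" if i: "i \<in> V" for i
  proof -
    have "(\<Sum>T | T \<subseteq> V \<and> i \<in> T. (a T)\<^sup>2) = avg V (\<lambda>x. (?D i x)\<^sup>2)"
      using sum_deriv_coeff[OF V, of "{i}" "\<lambda>_ t. t\<^sup>2" a] i by (simp add: parseval[OF V])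
    then have "sqrt (\<Sum>T | T \<subseteq> V \<and> i \<in> T. (a T)\<^sup>2) = (avg V (\<lambda>x. (?D i x)\<^sup>2)) powr (1 / 2)"
      by (simp add: powr_half_sqrt avg_nonneg)
    also have "\<dots> \<le> (9 ^ k) powr (1 - 1 / 2) * avg V (\<lambda>x. ((?D i x)\<^sup>2) powr (1 / 2))"
    proof (rule moment_interpolation)
      have "avg V (\<lambda>x. (?D i x) ^ 4) \<le> 9 ^ k * (avg V (\<lambda>x. (?D i x)\<^sup>2))\<^sup>2"
        using deriv_coeff_degree[OF V _ deg, of "{i}"] i by (intro bonami_fourth_moment[OF V]) auto
      then show "avg V (\<lambda>x. ((?D i x)\<^sup>2)\<^sup>2) \<le> 9 ^ k * (avg V (\<lambda>x. (?D i x)\<^sup>2))\<^sup>2"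
        by (simp flip: power_mult)
    qed auto
    also have "(9 ^ k) powr (1 - 1 / 2) = (3::real) ^ k"
    proof -
      have "(9::real) ^ k = (3 ^ k)\<^sup>2" by (simp add: power2_eq_square flip: power_mult_distrib)
      then show ?thesis by (simp add: powr_half_sqrt)
    qed
    finally show ?thesis by (simp add: powr_half_sqrt)
  qed
  have pt: "(\<Sum>i\<in>V. \<bar>?D i x\<bar>) \<le> 6 * real k ^ 3 * B" if x: "x \<in> signs V" for x
  proof -
    define y where "y = (\<lambda>i\<in>V. if ?D i x \<ge> 0 then 1 else - 1 :: real)"
    have y: "y \<in> signs V" unfolding signs_def y_def by auto
    have "(\<Sum>i\<in>V. \<bar>?D i x\<bar>) = walsh_sum V (dir_deriv V y a) x"
      unfolding walsh_sum_dir_deriv by (intro sum.cong) (auto simp: y_def)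
    also have "\<dots> \<le> \<bar>\<dots>\<bar>" by (rule abs_ge_self)
    also have "\<dots> \<le> 6 * real k ^ 3 * B"
      by (rule dir_deriv_bound[OF V _ _ x y]) (use deg bound in auto)
    finally show ?thesis .
  qed
  have "(\<Sum>i\<in>V. sqrt (\<Sum>T | T \<subseteq> V \<and> i \<in> T. (a T)\<^sup>2)) \<le> (\<Sum>i\<in>V. 3 ^ k * avg V (\<lambda>x. \<bar>?D i x\<bar>))"
    by (rule sum_mono) (rule norm)
  also have "\<dots> = 3 ^ k * avg V (\<lambda>x. \<Sum>i\<in>V. \<bar>?D i x\<bar>)"
    by (simp add: avg_sum sum_distrib_left)
  also have "\<dots> \<le> 3 ^ k * avg V (\<lambda>x. 6 * real k ^ 3 * B)"
    by (intro mult_left_mono avg_mono pt) auto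
  finally show ?thesis by (simp only: avg_const[OF V])
qed

section \<open>A Bohnenblust-Hille inequality with a small exponential loss\<close>

lemma card_slice_between:
  assumes V: "finite V" and T: "T \<in> slice V k" and kd: "k \<le> d"
  shows "card {S. S \<subseteq> V \<and> card S = d \<and> T \<subseteq> S} = (card V - k) choose (d - k)"
proof -
  have fT: "finite T" "T \<subseteq> V" "card T = k" using T V finite_subset by (auto simp: slice_def)
  have fin: "finite S" if "S \<subseteq> V" for S using V that finite_subset by blast
  have "bij_betw (\<lambda>S. S - T) {S. S \<subseteq> V \<and> card S = d \<and> T \<subseteq> S} (slice (V - T) (d - k))"
  proof (rule bij_betw_byWitness[where f' = "\<lambda>R. R \<union> T"])
    show "(\<lambda>S. S - T) ` {S. S \<subseteq> V \<and> card S = d \<and> T \<subseteq> S} \<subseteq> slice (V - T) (d - k)"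
      using fT by (auto simp: slice_def card_Diff_subset)
    have "card (R \<union> T) = d" if "R \<subseteq> V - T" "card R = d - k" for R
      using that fT fin[of R] kd by (subst card_Un_disjoint) auto
    then show "(\<lambda>R. R \<union> T) ` slice (V - T) (d - k) \<subseteq> {S. S \<subseteq> V \<and> card S = d \<and> T \<subseteq> S}"
      using fT by (auto simp: slice_def)
  qed (auto simp: slice_def)
  then have "card {S. S \<subseteq> V \<and> card S = d \<and> T \<subseteq> S} = card (slice (V - T) (d - k))"
    by (rule bij_betw_same_card)
  then show ?thesis using V fT by (simp add: card_slice card_Diff_subset)
qed

text \<open>
  The mixed derivatives of order \<open>k\<close> at \<open>x\<close> are the coefficients of the \<open>k\<close>-th directional derivative,
  a bounded \<open>k\<close>-homogeneous function of the direction, to which the bound for first order derivatives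
  and Blei's inequality apply.
\<close>

lemma bohnenblust_hille_derivatives:
  assumes V: "finite V" and k: "1 \<le> k" and deg: "\<And>S. S \<subseteq> V \<Longrightarrow> d < card S \<Longrightarrow> c S = 0"
    and bound: "\<And>x. x \<in> signs V \<Longrightarrow> \<bar>walsh_sum V c x\<bar> \<le> A"
    and x: "x \<in> signs V"
  shows "(\<Sum>T\<in>slice V k. ((walsh_sum V (deriv_coeff T c) x)\<^sup>2) powr (real k / real (k + 1)))
       \<le> 2 * ((3 ^ k * (6 * real k ^ 3 * ((6 * real d ^ 3) ^ k * A)))\<^sup>2) powr (real k / real (k + 1))"
    (is "_ \<le> 2 * (?M\<^sup>2) powr _")
proof -
  define a where "a = (\<lambda>T. if T \<in> slice V k then walsh_sum V (deriv_coeff T c) x else 0)"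
  have wa: "walsh_sum V a y = walsh_sum V (iter_deriv V k y c) x" for y
  proof -
    have "walsh_sum V a y = (\<Sum>T\<in>slice V k. walsh T y * walsh_sum V (deriv_coeff T c) x)"
      unfolding walsh_sum_def[of V a] using V
      by (intro sum.mono_neutral_cong_right) (auto simp: a_def slice_def)
    also have "\<dots> = walsh_sum V (iter_deriv V k y c) x"
      unfolding iter_deriv_def by (rule walsh_sum_linear[symmetric])
    finally show ?thesis .
  qed
  have "(\<Sum>i\<in>V. sqrt (\<Sum>T | T \<subseteq> V \<and> i \<in> T. (a T)\<^sup>2)) \<le> ?M"
  proof (rule sum_norm_deriv_le[OF V])
    show "\<bar>walsh_sum V a y\<bar> \<le> (6 * real d ^ 3) ^ k * A" if "y \<in> signs V" for y
      unfolding wa by (rule iter_deriv_bound[OF V _ _ that x]) (use deg bound in auto)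
  qed (auto simp: a_def slice_def)
  moreover have "(\<Sum>T | T \<in> slice V k \<and> i \<in> T. (a T)\<^sup>2) = (\<Sum>T | T \<subseteq> V \<and> i \<in> T. (a T)\<^sup>2)" for i
    using V by (intro sum.mono_neutral_left) (auto simp: a_def slice_def)
  ultimately have "(\<Sum>T\<in>slice V k. ((a T)\<^sup>2) powr (real k / real (k + 1))) \<le> 2 * (?M\<^sup>2) powr (real k / real (k + 1))"
    by (intro blei_inequality[OF V k]) auto
  then show ?thesis by (simp add: a_def)
qed

text \<open>
  The bound for the coefficients at a fixed point \<open>x\<close> holds for powers of order \<open>2 * r < 2\<close>. It is averaged
  over \<open>x\<close>, converted to \<open>L2\<close> norms by \<open>moment_interpolation\<close>, and converted from an \<open>\<ell>\<^sub>p\<close> to an \<open>\<ell>\<^sub>1\<close>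
  bound over the \<open>T\<close> by Hoelder's inequality. The exponent of the binomial coefficient stays below
  \<open>1 / 2\<close> because \<open>p < 2\<close>.
\<close>

lemma sum_norm_iter_deriv_le:
  assumes V: "finite V" and k: "1 \<le> k" and deg: "\<And>S. S \<subseteq> V \<Longrightarrow> d < card S \<Longrightarrow> c S = 0"
    and bound: "\<And>x. x \<in> signs V \<Longrightarrow> \<bar>walsh_sum V c x\<bar> \<le> A"
  shows "(\<Sum>T\<in>slice V k. sqrt (\<Sum>S | S \<subseteq> V \<and> T \<subseteq> S. (c S)\<^sup>2))
       \<le> real (card V choose k) powr (1 / 2 - 1 / (2 * real k)) * 3 powr (real d / real k)
          * (2 * 3 ^ k * 6 * real k ^ 3 * (6 * real d ^ 3) ^ k * A)"
proof -
  define r where "r = real k / real (k + 1)"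
  define q where "q = real (k + 1) / (2 * real k)"
  define M where "M = 3 ^ k * (6 * real k ^ 3 * ((6 * real d ^ 3) ^ k * A))"
  define \<sigma> where "\<sigma> T = (\<Sum>S | S \<subseteq> V \<and> T \<subseteq> S. (c S)\<^sup>2)" for T
  let ?a = "\<lambda>T. walsh_sum V (deriv_coeff T c)"
  obtain x0 where "x0 \<in> signs V" using card_signs[OF V] by (metis card.empty ex_in_conv power_not_zero zero_neq_numeral)
  then have A: "A \<ge> 0" using bound by force
  have M: "M \<ge> 0" using A by (simp add: M_def)
  have r: "0 < r" "r \<le> 1" using k by (auto simp: r_def)
  have q: "0 < q" "q \<le> 1" using k by (auto simp: q_def)
  have rq: "r * q = 1 / 2" using k by (simp add: r_def q_def)
  have \<sigma>: "\<sigma> T \<ge> 0" for T by (simp add: \<sigma>_def sum_nonneg)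
  have "\<sigma> T powr r \<le> (9 ^ d) powr (1 - r) * avg V (\<lambda>x. ((?a T x)\<^sup>2) powr r)" if T: "T \<in> slice V k" for T
  proof -
    have TV: "T \<subseteq> V" using T by (simp add: slice_def)
    have "\<sigma> T = avg V (\<lambda>x. (?a T x)\<^sup>2)"
      unfolding \<sigma>_def parseval[OF V] using sum_deriv_coeff[OF V TV, of "\<lambda>_ t. t\<^sup>2" c] by simp
    moreover have "avg V (\<lambda>x. (?a T x) ^ 4) \<le> 9 ^ d * (avg V (\<lambda>x. (?a T x)\<^sup>2))\<^sup>2"
    proof (rule bonami_fourth_moment[OF V])
      fix S assume "S \<subseteq> V" "d < card S"
      then show "deriv_coeff T c S = 0" using deg by (intro deriv_coeff_degree[OF V TV]) auto
    qed
    ultimately show ?thesis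
      using r by (simp only:) (rule moment_interpolation, auto simp flip: power_mult)
  qed
  then have "(\<Sum>T\<in>slice V k. \<sigma> T powr r) \<le> (\<Sum>T\<in>slice V k. (9 ^ d) powr (1 - r) * avg V (\<lambda>x. ((?a T x)\<^sup>2) powr r))"
    by (rule sum_mono)
  also have "\<dots> = (9 ^ d) powr (1 - r) * avg V (\<lambda>x. \<Sum>T\<in>slice V k. ((?a T x)\<^sup>2) powr r)"
    by (simp add: avg_sum sum_distrib_left)
  also have "\<dots> \<le> (9 ^ d) powr (1 - r) * avg V (\<lambda>x. 2 * (M\<^sup>2) powr r)"
    unfolding r_def M_def
    by (intro mult_left_mono avg_mono bohnenblust_hille_derivatives[OF V k]) (use deg bound in auto)
  also have "\<dots> = (9 ^ d) powr (1 - r) * (2 * (M\<^sup>2) powr r)" by (simp add: avg_const[OF V])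
  finally have sum_r: "(\<Sum>T\<in>slice V k. \<sigma> T powr r) \<le> (9 ^ d) powr (1 - r) * (2 * (M\<^sup>2) powr r)" .
  have "(\<Sum>T\<in>slice V k. sqrt (\<sigma> T)) = (\<Sum>T\<in>slice V k. (\<sigma> T powr r) powr q)"
    using \<sigma> by (simp add: powr_powr rq powr_half_sqrt)
  also have "\<dots> \<le> real (card V choose k) powr (1 - q) * (\<Sum>T\<in>slice V k. \<sigma> T powr r) powr q"
    using sum_powr_le_card_powr[OF finite_slice[OF V], of k "\<lambda>T. \<sigma> T powr r" q] q by (simp add: card_slice[OF V])
  also have "\<dots> \<le> real (card V choose k) powr (1 - q) * ((9 ^ d) powr (1 - r) * (2 * (M\<^sup>2) powr r)) powr q"
    using sum_r q by (intro mult_left_mono powr_mono2) (auto intro: sum_nonneg)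
  also have "\<dots> = real (card V choose k) powr (1 - q) * ((9 ^ d) powr ((1 - r) * q) * (2 powr q * M))"
    using M by (simp add: powr_mult powr_powr rq powr_half_sqrt)
  also have "\<dots> \<le> real (card V choose k) powr (1 - q) * ((9 ^ d) powr ((1 - r) * q) * (2 powr 1 * M))"
    using q M by (intro mult_left_mono mult_right_mono powr_mono) auto
  also have "(9 ^ d) powr ((1 - r) * q) = (3::real) powr (real d / real k)"
  proof -
    have "(9::real) ^ d = 3 powr (2 * real d)"
      by (simp add: powr_realpow[symmetric] powr_powr[symmetric])
    moreover have "2 * real d * ((1 - r) * q) = real d / real k"
      using k by (simp add: r_def q_def field_simps)
    ultimately show ?thesis by (simp add: powr_powr)
  qed
  also have "1 - q = 1 / 2 - 1 / (2 * real k)" using k by (simp add: q_def field_simps)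
  finally show ?thesis by (simp add: \<sigma>_def M_def mult_ac)
qed

text \<open>
  Every \<open>S\<close> of size \<open>d\<close> contains at least one \<open>T\<close> of size \<open>k\<close>. For fixed \<open>T\<close> the coefficients
  with \<open>T \<subseteq> S\<close> are summed by the Cauchy-Schwarz inequality.
\<close>

lemma coefficient_sum_le_binomial:
  assumes V: "finite V" and k: "1 \<le> k" "k \<le> d" and hom: "\<And>S. S \<subseteq> V \<Longrightarrow> card S \<noteq> d \<Longrightarrow> c S = 0"
    and bound: "\<And>x. x \<in> signs V \<Longrightarrow> \<bar>walsh_sum V c x\<bar> \<le> A"
  shows "(\<Sum>S\<in>Pow V. \<bar>c S\<bar>)
       \<le> sqrt (real ((card V - k) choose (d - k))) * real (card V choose k) powr (1 / 2 - 1 / (2 * real k))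
          * 3 powr (real d / real k) * (2 * 3 ^ k * 6 * real k ^ 3 * (6 * real d ^ 3) ^ k * A)"
proof -
  have "(\<Sum>S\<in>Pow V. \<bar>c S\<bar>) \<le> (\<Sum>S\<in>Pow V. \<Sum>T | T \<in> slice V k \<and> T \<subseteq> S. \<bar>c S\<bar>)"
  proof (intro sum_mono)
    fix S assume S: "S \<in> Pow V"
    show "\<bar>c S\<bar> \<le> (\<Sum>T | T \<in> slice V k \<and> T \<subseteq> S. \<bar>c S\<bar>)"
    proof (cases "card S = d")
      case True
      have "finite S" using S V finite_subset by auto
      have "{T. T \<in> slice V k \<and> T \<subseteq> S} = slice S k" using S by (auto simp: slice_def)
      then have "card {T. T \<in> slice V k \<and> T \<subseteq> S} = d choose k"
        using True by (simp add: card_slice[OF \<open>finite S\<close>])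
      moreover have "1 \<le> d choose k" using k(2) by (simp add: Suc_le_eq)
      then have "1 * \<bar>c S\<bar> \<le> real (d choose k) * \<bar>c S\<bar>"
        by (intro mult_right_mono) linarith+
      ultimately show ?thesis by simp
    next
      case False
      then show ?thesis using hom S by simp
    qed
  qed
  also have "\<dots> = (\<Sum>T\<in>slice V k. \<Sum>S | S \<in> Pow V \<and> T \<subseteq> S. \<bar>c S\<bar>)"
    using V by (intro sum.swap_restrict finite_slice) auto
  also have "\<dots> \<le> (\<Sum>T\<in>slice V k. sqrt (real ((card V - k) choose (d - k))) * sqrt (\<Sum>S | S \<subseteq> V \<and> T \<subseteq> S. (c S)\<^sup>2))"
  proof (intro sum_mono)
    fix T assume T: "T \<in> slice V k"
    let ?I = "{S. S \<subseteq> V \<and> card S = d \<and> T \<subseteq> S}"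
    have fin: "finite {S. S \<in> Pow V \<and> T \<subseteq> S}" using V by simp
    have "(\<Sum>S | S \<in> Pow V \<and> T \<subseteq> S. \<bar>c S\<bar>) = (\<Sum>S\<in>?I. 1 * \<bar>c S\<bar>)"
      using fin hom by (intro sum.mono_neutral_cong_right) auto
    also have "\<dots> \<le> sqrt ((\<Sum>S\<in>?I. 1\<^sup>2) * (\<Sum>S\<in>?I. \<bar>c S\<bar>\<^sup>2))"
      by (intro real_le_rsqrt Cauchy_Schwarz_ineq_sum)
    also have "\<dots> = sqrt (real ((card V - k) choose (d - k)) * (\<Sum>S\<in>?I. (c S)\<^sup>2))"
      by (simp add: card_slice_between[OF V T k(2)])
    also have "(\<Sum>S\<in>?I. (c S)\<^sup>2) = (\<Sum>S | S \<subseteq> V \<and> T \<subseteq> S. (c S)\<^sup>2)"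
      using fin hom by (intro sum.mono_neutral_cong_left) auto
    finally show "(\<Sum>S | S \<in> Pow V \<and> T \<subseteq> S. \<bar>c S\<bar>)
        \<le> sqrt (real ((card V - k) choose (d - k))) * sqrt (\<Sum>S | S \<subseteq> V \<and> T \<subseteq> S. (c S)\<^sup>2)"
      by (simp add: real_sqrt_mult)
  qed
  also have "\<dots> = sqrt (real ((card V - k) choose (d - k))) * (\<Sum>T\<in>slice V k. sqrt (\<Sum>S | S \<subseteq> V \<and> T \<subseteq> S. (c S)\<^sup>2))"
    by (simp add: sum_distrib_left)
  also have "\<dots> \<le> sqrt (real ((card V - k) choose (d - k))) *
      (real (card V choose k) powr (1 / 2 - 1 / (2 * real k)) * 3 powr (real d / real k)
          * (2 * 3 ^ k * 6 * real k ^ 3 * (6 * real d ^ 3) ^ k * A))"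
    by (intro mult_left_mono sum_norm_iter_deriv_le[OF V k(1) _ bound]) (use hom in auto)
  finally show ?thesis by (simp only: mult.assoc)
qed

section \<open>Optimisation over the degree\<close>

lemma power_div_fact_le_exp: "x ^ n / fact n \<le> exp x" if "0 \<le> x" for x :: real
proof -
  have "(\<Sum>j\<in>{n}. x ^ j /\<^sub>R fact j) \<le> (\<Sum>j. x ^ j /\<^sub>R fact j)"
    using that by (intro sum_le_suminf summable_exp_generic) auto
  then show ?thesis by (simp add: exp_def divide_inverse mult.commute)
qed

lemma binomial_le_exp:
  assumes "1 \<le> d" "1 \<le> N"
  shows "real (N choose d) \<le> exp (real d + real d * ln N - real d * ln d)"
proof -
  have "real (N choose d) * fact d \<le> real N ^ d"
    using binomial_fact_pow[of N d] by (metis of_nat_fact of_nat_le_iff of_nat_mult of_nat_power)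
  then have "real (N choose d) \<le> real N ^ d / fact d" by (simp add: field_simps)
  also have "\<dots> = (real d ^ d / fact d) * (real N ^ d / real d ^ d)" using assms by simp
  also have "\<dots> \<le> exp (real d) * (real N ^ d / real d ^ d)"
    by (intro mult_right_mono power_div_fact_le_exp) auto
  also have "\<dots> = exp (real d + real d * ln N - real d * ln d)"
    using assms by (simp add: exp_add exp_diff ln_realpow[symmetric])
  finally show ?thesis .
qed

text \<open>
  Since \<open>(N choose d) * (d choose k) = (N choose k) * ((N - k) choose (d - k))\<close>, the square roots
  combine to \<open>sqrt (N choose d)\<close> up to a power of \<open>d\<close>. The remaining negative power of \<open>N choose k\<close> is at
  most \<open>sqrt (k / N)\<close>.
\<close>

lemma sqrt_binomial_times_powr_le:
  assumes k: "1 \<le> k" "k \<le> d" and d: "d \<le> N"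
  shows "sqrt (real ((N - k) choose (d - k))) * real (N choose k) powr (1 / 2 - 1 / (2 * real k))
       \<le> sqrt (real k) * real d ^ k * exp ((real d + real d * ln N - real d * ln d - ln N) / 2)"
proof -
  let ?n = "real (N choose k)"
  have n: "?n \<ge> 1" using k d by (simp add: Suc_le_eq)
  have "?n powr (1 / 2 - 1 / (2 * real k)) = sqrt ?n * ?n powr (- (1 / (2 * real k)))"
    using powr_add[of ?n "1 / 2" "- (1 / (2 * real k))"] n by (simp add: powr_half_sqrt)
  also have "\<dots> \<le> sqrt ?n * (((real N / real k) ^ k) powr (- (1 / (2 * real k))))"
    using binomial_ge_n_over_k_pow_k[of k N, where 'a = real] k d
    by (intro mult_left_mono powr_mono2') auto
  also have "((real N / real k) ^ k) powr (- (1 / (2 * real k))) = (real N / real k) powr (- (1 / 2))"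
    using k d by (simp add: powr_realpow[symmetric] powr_powr)
  also have "\<dots> = sqrt (real k) * exp (- ln N / 2)"
    using k d by (simp add: powr_minus powr_divide powr_half_sqrt[symmetric] exp_minus)
      (simp add: powr_def field_simps)
  finally have *: "?n powr (1 / 2 - 1 / (2 * real k)) \<le> sqrt ?n * (sqrt (real k) * exp (- ln N / 2))" .
  have "sqrt (real ((N - k) choose (d - k))) * sqrt ?n = sqrt (real (N choose d) * real (d choose k))"
    using choose_mult[OF k(2) d] by (simp add: real_sqrt_mult[symmetric] mult.commute flip: of_nat_mult)
  also have "\<dots> \<le> sqrt (exp (real d + real d * ln N - real d * ln d) * (real d ^ k)\<^sup>2)"
  proof (intro real_sqrt_le_mono mult_mono binomial_le_exp)
    have "real (d choose k) \<le> real d ^ k" 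
      using binomial_le_pow[OF k(2)] by (metis of_nat_le_iff of_nat_power)
    also have "\<dots> \<le> (real d ^ k)\<^sup>2" using k d by (intro self_le_power one_le_power) auto
    finally show "real (d choose k) \<le> (real d ^ k)\<^sup>2" .
  qed (use k d in auto)
  also have "\<dots> = exp ((real d + real d * ln N - real d * ln d) / 2) * real d ^ k"
    by (simp add: real_sqrt_mult exp_half_le2 flip: powr_half_sqrt) (simp add: powr_def)
  finally have **: "sqrt (real ((N - k) choose (d - k))) * sqrt ?n \<le> exp ((real d + real d * ln N - real d * ln d) / 2) * real d ^ k" .
  have "sqrt (real ((N - k) choose (d - k))) * ?n powr (1 / 2 - 1 / (2 * real k))
      \<le> sqrt (real ((N - k) choose (d - k))) * (sqrt ?n * (sqrt (real k) * exp (- ln N / 2)))"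
    by (rule mult_left_mono[OF *]) simp
  also have "\<dots> = (sqrt (real ((N - k) choose (d - k))) * sqrt ?n) * (sqrt (real k) * exp (- ln N / 2))"
    by simp
  also have "\<dots> \<le> (exp ((real d + real d * ln N - real d * ln d) / 2) * real d ^ k) * (sqrt (real k) * exp (- ln N / 2))"
    by (rule mult_right_mono[OF **]) simp
  also have "\<dots> = sqrt (real k) * real d ^ k * (exp ((real d + real d * ln N - real d * ln d) / 2) * exp (- ln N / 2))"
    by simp
  also have "exp ((real d + real d * ln N - real d * ln d) / 2) * exp (- ln N / 2)
      = exp ((real d + real d * ln N - real d * ln d - ln N) / 2)"
    by (simp add: diff_divide_distrib flip: exp_add)
  finally show ?thesis .
qed

text \<open>
  For degrees \<open>d < k\<close> derivatives of order \<open>d\<close> are used instead; the constants increase with the order,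
  and \<open>3 powr (d / d)\<close> is absorbed by an additional factor \<open>3\<close>.
\<close>

lemma homogeneous_coefficient_sum_le:
  assumes V: "finite V" and k: "1 \<le> k" and d: "1 \<le> d" "d \<le> card V"
    and hom: "\<And>S. S \<subseteq> V \<Longrightarrow> card S \<noteq> d \<Longrightarrow> c S = 0"
    and bound: "\<And>x. x \<in> signs V \<Longrightarrow> \<bar>walsh_sum V c x\<bar> \<le> A"
  shows "(\<Sum>S\<in>Pow V. \<bar>c S\<bar>)
       \<le> 36 * 18 ^ k * sqrt (real k) * real k ^ 3 * real d ^ (4 * k) * 3 powr (real d / real k)
          * exp ((real d + real d * ln (card V) - real d * ln d - ln (card V)) / 2) * A"
proof -
  define j where "j = min k d"
  have j: "1 \<le> j" "j \<le> d" "j \<le> k" using k d by (auto simp: j_def)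
  let ?E = "exp ((real d + real d * ln (card V) - real d * ln d - ln (card V)) / 2)"
  obtain x0 where "x0 \<in> signs V" using card_signs[OF V] by (metis card.empty ex_in_conv power_not_zero zero_neq_numeral)
  then have A: "A \<ge> 0" using bound by force
  have pow3: "3 powr (real d / real j) \<le> 3 * 3 powr (real d / real k)"
  proof (cases "k \<le> d")
    case True
    then have "j = k" by (simp add: j_def)
    then show ?thesis by simp
  next
    case False
    then have "real d / real j = 1" using d by (simp add: j_def)
    moreover have "1 \<le> 3 powr (real d / real k)" by (rule ge_one_powr_ge_zero) auto
    ultimately show ?thesis by simp
  qed
  have "(\<Sum>S\<in>Pow V. \<bar>c S\<bar>)
      \<le> (sqrt (real ((card V - j) choose (d - j))) * real (card V choose j) powr (1 / 2 - 1 / (2 * real j)))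
          * 3 powr (real d / real j) * (2 * 3 ^ j * 6 * real j ^ 3 * (6 * real d ^ 3) ^ j * A)"
    by (rule coefficient_sum_le_binomial[OF V j(1,2) _ bound]) (use hom in auto)
  also have "\<dots> \<le> (sqrt (real j) * real d ^ j * ?E)
          * 3 powr (real d / real j) * (2 * 3 ^ j * 6 * real j ^ 3 * (6 * real d ^ 3) ^ j * A)"
    using A by (intro mult_right_mono sqrt_binomial_times_powr_le[OF j(1,2) d(2)]) auto
  also have "\<dots> \<le> (sqrt (real k) * real d ^ k * ?E)
          * (3 * 3 powr (real d / real k)) * (2 * 3 ^ k * 6 * real k ^ 3 * (6 * real d ^ 3) ^ k * A)"
  proof (intro mult_mono power_mono power_increasing pow3 real_sqrt_le_mono order_refl)
    have "1 \<le> real d ^ 3" using d by (intro one_le_power) auto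
    then show "1 \<le> 6 * real d ^ 3" by linarith
  qed (use j d A in auto)
  also have "\<dots> = 36 * 18 ^ k * sqrt (real k) * real k ^ 3 * real d ^ (4 * k) * 3 powr (real d / real k) * ?E * A"
  proof -
    have "real d ^ (4 * k) = real d ^ k * (real d ^ 3) ^ k"
      by (simp flip: power_mult power_add)
    moreover have "(18::real) ^ k = 3 ^ k * 6 ^ k" by (simp flip: power_mult_distrib)
    ultimately show ?thesis by (simp add: power_mult_distrib)
  qed
  finally show ?thesis .
qed

text \<open>
  Let \<open>L = ln N\<close>. After taking logarithms and comparing with \<open>d * ln (sqrt (N / L))\<close>, the main term is
  \<open>(d - d * ln d - L + d * ln L) / 2\<close>. It is never positive, as \<open>ln (L / d) \<le> L / d - 1\<close>; this is where
  the constant \<open>1\<close> of the theorem comes from. For large \<open>d\<close> the slack \<open>d * \<eta> / 2\<close> pays for \<open>C\<close> and for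
  the power of \<open>d\<close>. For the finitely many other \<open>d\<close> the term \<open>- L / 2\<close> does.
\<close>

lemma eventually_homogeneous_estimate:
  fixes C \<eta> :: real and k :: nat
  assumes C: "C > 0" and \<eta>: "\<eta> > 0" and k: "k \<ge> 1" "ln 3 / real k \<le> \<eta> / 2"
  shows "eventually (\<lambda>N::nat. \<forall>d\<ge>1. C * real d ^ (4 * k) * 3 powr (real d / real k)
           * exp ((real d + real d * ln N - real d * ln d - ln N) / 2) \<le> (exp \<eta> * sqrt (N / ln N)) ^ d) sequentially"
proof -
  have "eventually (\<lambda>x::real. ln C + real (4 * k) * ln x \<le> x * (\<eta> / 2)) at_top"
    using \<eta> k by real_asymp
  then have "eventually (\<lambda>d::nat. ln C + real (4 * k) * ln (real d) \<le> real d * (\<eta> / 2)) sequentially"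
    by (rule eventually_compose_filterlim[OF _ filterlim_real_sequentially])
  then obtain d0 where d0: "\<And>d::nat. d \<ge> d0 \<Longrightarrow> ln C + real (4 * k) * ln (real d) \<le> real d * (\<eta> / 2)"
    unfolding eventually_sequentially by blast
  define D where "D = real d0 + 1"
  define B where "B = \<bar>ln C\<bar> + real (4 * k) * ln D"
  have "eventually (\<lambda>N::nat. D + D * ln (ln (real N)) + 2 * B \<le> ln (real N)) sequentially"
    by real_asymp
  moreover have "eventually (\<lambda>N::nat. 1 \<le> ln (real N)) sequentially" by real_asymp
  ultimately show ?thesis
  proof eventually_elim
    case (elim N)
    define L where "L = ln (real N)"
    have L: "1 \<le> L" "D + D * ln L + 2 * B \<le> L" using elim by (simp_all add: L_def)
    have N: "N > 1" using L(1) by (cases "N \<le> 1") (auto simp: L_def le_Suc_eq)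
    show ?case
    proof (intro allI impI)
      fix d :: nat assume d: "1 \<le> d"
      have lnd: "0 \<le> ln (real d)" using d by simp
      have lnL: "0 \<le> ln L" using L by simp
      have key: "ln C + real (4 * k) * ln d + (real d - real d * ln d - L + real d * ln L) / 2 \<le> real d * (\<eta> / 2)"
      proof (cases "d \<ge> d0")
        case True
        have "ln (L / d) \<le> L / d - 1" using L d by (intro ln_le_minus_one) auto
        then have "real d * (1 + ln (L / d)) \<le> real d * (L / d)" by (intro mult_left_mono) auto
        then have "real d - real d * ln d - L + real d * ln L \<le> 0"
          using d L by (simp add: ln_div algebra_simps)
        then have "(real d - real d * ln d - L + real d * ln L) / 2 \<le> 0" by simp
        from add_mono[OF d0[OF True] this] show ?thesis by simp
      next
        case False
        then have dD: "real d \<le> D" by (simp add: D_def)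
        then have "ln (real d) \<le> ln D" using d by simp
        then have "ln C + real (4 * k) * ln d \<le> B"
          unfolding B_def by (intro add_mono mult_left_mono) auto
        moreover have "real d * ln L \<le> D * ln L" using dD lnL by (rule mult_right_mono)
        moreover have "0 \<le> real d * ln d" using lnd by simp
        moreover have "0 \<le> real d * (\<eta> / 2)" using \<eta> by simp
        ultimately show ?thesis using L dD by argo
      qed
      have "real d / real k * ln 3 \<le> real d * (\<eta> / 2)"
        using mult_left_mono[OF k(2), of "real d"] by simp
      then have exponent: "ln C + real (4 * k) * ln d + real d / real k * ln 3 + (real d + real d * L - real d * ln d - L) / 2
          \<le> real d * (\<eta> + (L - ln L) / 2)"
        using key by (simp add: algebra_simps) argo
      have "C * real d ^ (4 * k) * 3 powr (real d / real k) * exp ((real d + real d * ln N - real d * ln d - ln N) / 2)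
          = exp (ln C + real (4 * k) * ln d + real d / real k * ln 3 + (real d + real d * L - real d * ln d - L) / 2)"
        using C d exp_of_nat_mult[of "4 * k" "ln (real d)"] by (simp add: exp_add powr_def L_def)
      also have "\<dots> \<le> exp (real d * (\<eta> + (L - ln L) / 2))" using exponent by simp
      also have "\<dots> = (exp \<eta> * exp ((L - ln L) / 2)) ^ d"
        by (simp add: exp_of_nat_mult exp_add)
      also have "exp ((L - ln L) / 2) = sqrt (N / ln N)"
      proof -
        have "sqrt (N / ln N) = exp (ln (N / ln N) / 2)"
          using N L by (simp add: powr_half_sqrt[symmetric] powr_def L_def)
        then show ?thesis using N L by (simp add: ln_div L_def)
      qed
      finally show "C * real d ^ (4 * k) * 3 powr (real d / real k) * exp ((real d + real d * ln N - real d * ln d - ln N) / 2)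
          \<le> (exp \<eta> * sqrt (N / ln N)) ^ d" .
    qed
  qed
qed

section \<open>Polynomials with random signs\<close>

text \<open>
  The function \<open>exp (- (x\<^sup>2 / 2)) * (exp x + exp (- x))\<close> decreases for \<open>x \<ge> 0\<close>.
\<close>

lemma exp_plus_exp_minus_le: "exp x + exp (- x) \<le> 2 * exp (x\<^sup>2 / 2)" for x :: real
proof -
  have *: "exp x + exp (- x) \<le> 2 * exp (x\<^sup>2 / 2)" if x: "x \<ge> 0" for x :: real
  proof -
    define h where "h = (\<lambda>x::real. x * (exp x + exp (- x)) - (exp x - exp (- x)))"
    have h: "h y \<ge> 0" if "y \<ge> 0" for y
    proof -
      have "h 0 \<le> h y"
      proof (rule DERIV_nonneg_imp_nondecreasing[OF that])
        fix z :: real assume "0 \<le> z" "z \<le> y"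
        then have "0 \<le> z * (exp z - exp (- z))" by simp
        moreover have "(h has_real_derivative z * (exp z - exp (- z))) (at z)"
          unfolding h_def by (auto intro!: derivative_eq_intros simp: algebra_simps)
        ultimately show "\<exists>D. (h has_real_derivative D) (at z) \<and> 0 \<le> D" by blast
      qed
      then show ?thesis by (simp add: h_def)
    qed
    define F where "F = (\<lambda>x::real. exp (- (x\<^sup>2 / 2)) * (exp x + exp (- x)))"
    have "F x \<le> F 0"
    proof (rule DERIV_nonpos_imp_nonincreasing[OF x])
      fix z :: real assume "0 \<le> z" "z \<le> x"
      then have "- (exp (- (z\<^sup>2 / 2)) * h z) \<le> 0" using h by simp
      moreover have "(F has_real_derivative - (exp (- (z\<^sup>2 / 2)) * h z)) (at z)"
        unfolding F_def h_def by (auto intro!: derivative_eq_intros simp: algebra_simps)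
      ultimately show "\<exists>D. (F has_real_derivative D) (at z) \<and> D \<le> 0" by blast
    qed
    then show ?thesis by (simp add: F_def exp_minus field_simps)
  qed
  show ?thesis using *[of x] *[of "- x"] by (cases "x \<ge> 0") auto
qed

text \<open>
  The exponential moment method. Averaged over all sign choices \<open>e\<close>, the sum over the cube of
  \<open>exp (l * f x) + exp (- l * f x)\<close> is at most \<open>2 ^ (card V + 1) * exp (card W * l\<^sup>2 / 2)\<close>. Some choice does not
  exceed the average, and then every single term obeys the same bound. The value of \<open>l\<close> minimises the
  resulting estimate.
\<close>

lemma exists_signs_small_norm:
  assumes V: "finite V" and W: "W \<subseteq> Pow V" "W \<noteq> {}"
  shows "\<exists>e\<in>signs W. \<forall>x\<in>signs V. \<bar>\<Sum>S\<in>W. e S * walsh S x\<bar> \<le> sqrt (2 * (real (card V) + 1) * ln 2 * real (card W))"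
proof -
  define m where "m = real (card W)"
  \<comment> \<open>The logarithm of the number of terms \<open>exp (l * f x)\<close>, \<open>exp (- l * f x)\<close>.\<close>
  define a where "a = (real (card V) + 1) * ln 2"
  define l where "l = sqrt (2 * a / m)"
  have fW: "finite W" using W V finite_subset by (metis finite_Pow_iff)
  have m: "m > 0" using fW W by (simp add: m_def card_gt_0_iff)
  have a: "a > 0" by (simp add: a_def add_nonneg_pos)
  have l: "l > 0" using a m by (simp add: l_def)
  let ?f = "\<lambda>e x. \<Sum>S\<in>W. e S * walsh S x"
  have half: "(\<Sum>e\<in>signs W. exp (t * ?f e x)) \<le> (2 * exp (l\<^sup>2 / 2)) ^ card W"
    if x: "x \<in> signs V" and t: "t = l \<or> t = - l" for x t
  proof -
    have "(\<Sum>e\<in>signs W. exp (t * ?f e x)) = (\<Sum>e\<in>signs W. \<Prod>S\<in>W. exp (t * (e S * walsh S x)))"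
      using fW by (simp add: exp_sum sum_distrib_left)
    also have "\<dots> = (\<Prod>S\<in>W. exp (t * (- 1 * walsh S x)) + exp (t * (1 * walsh S x)))"
      by (rule sum_signs_prod[OF fW, of "\<lambda>S s. exp (t * (s * walsh S x))"])
    also have "\<dots> \<le> (\<Prod>S\<in>W. 2 * exp (l\<^sup>2 / 2))"
    proof (intro prod_mono conjI)
      fix S assume "S \<in> W"
      then have "\<bar>walsh S x\<bar> = 1" using abs_walsh[OF x] W by blast
      then have "(t * walsh S x)\<^sup>2 = l\<^sup>2" using t by (auto simp: power_mult_distrib simp flip: power2_abs[of "walsh S x"])
      then show "exp (t * (- 1 * walsh S x)) + exp (t * (1 * walsh S x)) \<le> 2 * exp (l\<^sup>2 / 2)"
        using exp_plus_exp_minus_le[of "t * walsh S x"] by (simp add: add.commute)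
    qed simp
    finally show ?thesis by simp
  qed
  have card_W: "card (signs W) = 2 ^ card W" by (rule card_signs[OF fW])
  let ?Z = "\<lambda>e. \<Sum>x\<in>signs V. exp (l * ?f e x) + exp (- l * ?f e x)"
  have "(\<Sum>e\<in>signs W. ?Z e) = (\<Sum>x\<in>signs V. (\<Sum>e\<in>signs W. exp (l * ?f e x)) + (\<Sum>e\<in>signs W. exp (- l * ?f e x)))"
    by (subst sum.swap) (simp add: sum.distrib)
  also have "\<dots> \<le> (\<Sum>x\<in>signs V. (2 * exp (l\<^sup>2 / 2)) ^ card W + (2 * exp (l\<^sup>2 / 2)) ^ card W)"
    by (intro sum_mono add_mono half) auto
  also have "\<dots> = (\<Sum>e\<in>signs W. 2 ^ (card V + 1) * exp (l\<^sup>2 / 2) ^ card W)"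
    by (simp add: card_signs[OF V] card_W power_mult_distrib)
  finally have "\<exists>e\<in>signs W. ?Z e \<le> 2 ^ (card V + 1) * exp (l\<^sup>2 / 2) ^ card W"
    using card_W sum_strict_mono[of "signs W" "\<lambda>_. 2 ^ (card V + 1) * exp (l\<^sup>2 / 2) ^ card W" ?Z] finite_signs[OF fW]
    by (metis (no_types, lifting) card.empty linorder_not_less power_not_zero zero_neq_numeral)
  then obtain e where e: "e \<in> signs W" and Z: "?Z e \<le> 2 ^ (card V + 1) * exp (l\<^sup>2 / 2) ^ card W" by blast
  have rhs: "2 ^ (card V + 1) * exp (l\<^sup>2 / 2) ^ card W = exp (a + m * (l\<^sup>2 / 2))"
  proof -
    have "exp (a + m * (l\<^sup>2 / 2)) = exp (real (card V + 1) * ln 2) * exp (real (card W) * (l\<^sup>2 / 2))"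
      by (simp add: a_def m_def exp_add)
    also have "\<dots> = exp (ln 2) ^ (card V + 1) * exp (l\<^sup>2 / 2) ^ card W"
      by (simp only: exp_of_nat_mult)
    finally show ?thesis by simp
  qed
  have "\<bar>?f e x\<bar> \<le> sqrt (2 * a * m)" if x: "x \<in> signs V" for x
  proof -
    have "exp (l * ?f e x) + exp (- l * ?f e x) \<le> ?Z e"
      using x finite_signs[OF V] by (intro member_le_sum) (auto simp: add_nonneg_nonneg)
    then have le: "exp (l * ?f e x) + exp (- l * ?f e x) \<le> exp (a + m * (l\<^sup>2 / 2))"
      using Z unfolding rhs by linarith
    have "exp (l * ?f e x) \<le> exp (a + m * (l\<^sup>2 / 2))" "exp (- l * ?f e x) \<le> exp (a + m * (l\<^sup>2 / 2))"
      using le exp_ge_zero[of "l * ?f e x"] exp_ge_zero[of "- l * ?f e x"] by linarith+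
    then have "l * ?f e x \<le> a + m * (l\<^sup>2 / 2)" "- l * ?f e x \<le> a + m * (l\<^sup>2 / 2)"
      by (simp_all only: exp_le_cancel_iff)
    then have "l * \<bar>?f e x\<bar> \<le> a + m * (l\<^sup>2 / 2)" by (simp add: abs_if)
    also have "\<dots> = 2 * a" using a m by (simp add: l_def)
    also have "\<dots> = l * sqrt (2 * a * m)"
    proof -
      have "l * sqrt (2 * a * m) = sqrt ((2 * a)\<^sup>2)"
        unfolding l_def real_sqrt_mult[symmetric] using m by (simp add: power2_eq_square)
      also have "sqrt ((2 * a)\<^sup>2) = 2 * a" by (rule real_sqrt_unique) (use a in auto)
      finally show ?thesis by simp
    qed
    finally show ?thesis using l by simp
  qed
  moreover have "2 * a * m = 2 * (real (card V) + 1) * ln 2 * real (card W)"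
    by (simp add: a_def m_def)
  ultimately show ?thesis using e by auto
qed

text \<open>
  The step from \<open>d\<close> to \<open>d + 1\<close> is \<open>(1 + 1 / d) ^ (d + 1) \<ge> exp 1\<close>.
\<close>

lemma fact_le_stirling: "d \<ge> 1 \<Longrightarrow> fact d \<le> real d ^ (d + 1) * exp (1 - real d)"
proof (induction d rule: nat_induct_at_least)
  case (Suc d)
  have "exp 1 * real d ^ (d + 1) \<le> real (Suc d) ^ (d + 1)"
  proof -
    have "1 + (- (1 / real (Suc d))) \<le> exp (- (1 / real (Suc d)))" by (rule exp_ge_add_one_self)
    moreover have "1 + (- (1 / real (Suc d))) = real d / real (Suc d)" by (simp add: field_simps)
    ultimately have "(real d / real (Suc d)) ^ (d + 1) \<le> exp (- (1 / real (Suc d))) ^ (d + 1)"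
      by (intro power_mono) auto
    also have "\<dots> = exp (real (d + 1) * (- (1 / real (Suc d))))" by (simp only: exp_of_nat_mult)
    also have "real (d + 1) * (- (1 / real (Suc d))) = - 1" by (simp add: field_simps)
    finally show ?thesis by (simp add: power_divide exp_minus field_simps del: power_Suc of_nat_Suc)
  qed
  then have "real (Suc d) * (exp 1 * real d ^ (d + 1)) * exp (- real d) \<le> real (Suc d) * real (Suc d) ^ (d + 1) * exp (- real d)"
    by (intro mult_right_mono mult_left_mono) auto
  moreover have "fact (Suc d) \<le> real (Suc d) * (real d ^ (d + 1) * exp (1 - real d))"
    using mult_left_mono[OF Suc.IH, of "real (Suc d)"] by simp
  moreover have "real (Suc d) * (real d ^ (d + 1) * exp (1 - real d)) = real (Suc d) * (exp 1 * real d ^ (d + 1)) * exp (- real d)"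
    by (simp add: exp_diff exp_minus field_simps)
  moreover have "real (Suc d) ^ (Suc d + 1) * exp (1 - real (Suc d)) = real (Suc d) * real (Suc d) ^ (d + 1) * exp (- real d)"
    by simp
  ultimately show ?case by linarith
qed simp

lemma power_le_binomial_times_fact:
  assumes "d \<le> N"
  shows "(real N - real d) ^ d \<le> real (N choose d) * fact d"
proof -
  have "(real N - real d) ^ d = (\<Prod>i = 0..<d. real N - real d)" by simp
  also have "\<dots> \<le> (\<Prod>i = 0..<d. real N - real i)"
    using assms by (intro prod_mono) auto
  also have "\<dots> = real (N choose d) * fact d"
    by (simp add: binomial_gbinomial gbinomial_prod_rev)
  finally show ?thesis .
qed

section \<open>Admissible radii\<close>

lemma cube_eq_signs: "cube N = signs {1..N}"
  by (simp add: cube_def signs_def)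

lemma fourier_coeff_eq_avg: "fourier_coeff N f S = avg {1..N} (\<lambda>x. f x * walsh S x)"
  by (simp add: fourier_coeff_def cube_expectation_def avg_def cube_eq_signs)

lemma le_cube_sup_norm: "x \<in> signs {1..N} \<Longrightarrow> \<bar>f x\<bar> \<le> cube_sup_norm N f"
  unfolding cube_sup_norm_def cube_eq_signs[symmetric] by (intro Max_ge) (auto simp: finite_cube)

lemma cube_sup_norm_le: "(\<And>x. x \<in> signs {1..N} \<Longrightarrow> \<bar>f x\<bar> \<le> A) \<Longrightarrow> cube_sup_norm N f \<le> A"
  unfolding cube_sup_norm_def using finite_cube[of N] cube_nonempty[of N]
  by (subst Max_le_iff) (auto simp: cube_eq_signs)

definition bohr_radii :: "nat \<Rightarrow> ((nat \<Rightarrow> real) \<Rightarrow> real) set \<Rightarrow> real set" where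
  "bohr_radii N F = {\<rho>. \<rho> \<ge> 0 \<and>
     (\<forall>f\<in>F. (\<Sum>S\<in>Pow {1..N}. \<bar>fourier_coeff N f S\<bar> * \<rho> ^ card S) \<le> cube_sup_norm N f)}"

lemma sqrt_ratio_pos: "0 < sqrt (real N / ln (real N))" if "1 \<le> ln (real N)"
proof -
  have "real N > 0" using that by (cases N) auto
  moreover have "ln (real N) > 0" using that by linarith
  ultimately show ?thesis by (simp only: real_sqrt_gt_0_iff divide_pos_pos)
qed

section \<open>The upper bound for the radius\<close>

text \<open>
  Testing with a homogeneous polynomial of small norm whose coefficients are signs: the absolute
  values of the coefficients sum up to \<open>N choose d\<close>, while the sup norm is at most of the order of its
  square root times \<open>sqrt N\<close>.
\<close>

lemma bohr_radius_power_le: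
  assumes d: "1 \<le> d" "d < N" and \<rho>: "\<rho> \<in> bohr_radii N (homogeneous_functions N)"
  shows "(\<rho>\<^sup>2) ^ d \<le> 4 * real N * (real d ^ (d + 1) * exp (1 - real d)) / (real N - real d) ^ d"
proof -
  let ?V = "{1..N}" and ?W = "slice {1..N} d"
  define m where "m = real (N choose d)"
  have m: "m > 0" using d by (simp add: m_def)
  have card_W: "card ?W = N choose d" by (simp add: card_slice)
  have "?W \<noteq> {}" using card_W d by (metis card.empty less_imp_le_nat zero_less_binomial less_irrefl)
  moreover have "?W \<subseteq> Pow ?V" by (auto simp: slice_def)
  ultimately obtain e where e: "e \<in> signs ?W"
    and e_small: "\<forall>x\<in>signs ?V. \<bar>\<Sum>S\<in>?W. e S * walsh S x\<bar> \<le> sqrt (2 * (real (card ?V) + 1) * ln 2 * real (card ?W))"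
    using exists_signs_small_norm[OF finite_atLeastAtMost, of ?W 1 N] by blast
  then have small: "\<bar>\<Sum>S\<in>?W. e S * walsh S x\<bar> \<le> sqrt (2 * (real N + 1) * ln 2 * m)" if "x \<in> signs ?V" for x
    using e_small that unfolding card_W m_def by simp
  define c where "c = (\<lambda>S. if S \<in> ?W then e S else 0)"
  let ?f = "walsh_sum ?V c"
  have f: "?f x = (\<Sum>S\<in>?W. e S * walsh S x)" for x
    unfolding walsh_sum_def c_def by (intro sum.mono_neutral_cong_right) (auto simp: slice_def)
  have coeff: "fourier_coeff N ?f S = c S" if "S \<subseteq> ?V" for S
    unfolding fourier_coeff_eq_avg using that by (intro avg_walsh_sum_mult_walsh) auto
  have "?f \<in> homogeneous_functions N"
    unfolding homogeneous_functions_def d_homogeneous_def using d coeff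
    by (auto intro!: exI[of _ d] simp: c_def slice_def)
  then have "(\<Sum>S\<in>Pow ?V. \<bar>fourier_coeff N ?f S\<bar> * \<rho> ^ card S) \<le> cube_sup_norm N ?f"
    using \<rho> unfolding bohr_radii_def by blast
  also have "\<dots> \<le> sqrt (2 * (real N + 1) * ln 2 * m)"
    using small by (intro cube_sup_norm_le) (simp only: f)
  also have "(\<Sum>S\<in>Pow ?V. \<bar>fourier_coeff N ?f S\<bar> * \<rho> ^ card S) = (\<Sum>S\<in>?W. \<rho> ^ d)"
  proof (intro sum.mono_neutral_cong_right)
    show "\<bar>fourier_coeff N ?f S\<bar> * \<rho> ^ card S = \<rho> ^ d" if "S \<in> ?W" for S
      using that signs_values[OF e that] coeff[of S] by (auto simp: slice_def c_def)
    show "\<forall>S\<in>Pow ?V - ?W. \<bar>fourier_coeff N ?f S\<bar> * \<rho> ^ card S = 0"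
      using coeff by (simp add: c_def)
  qed (auto simp: slice_def)
  also have "\<dots> = m * \<rho> ^ d" by (simp only: sum_constant card_W m_def)
  finally have "m * \<rho> ^ d \<le> sqrt (2 * (real N + 1) * ln 2 * m)" .
  moreover have "0 \<le> \<rho>" using \<rho> by (simp add: bohr_radii_def)
  ultimately have "(m * \<rho> ^ d)\<^sup>2 \<le> (sqrt (2 * (real N + 1) * ln 2 * m))\<^sup>2"
    using m by (intro power_mono) auto
  also have "\<dots> = 2 * (real N + 1) * ln 2 * m" using m by simp
  finally have "m * (m * (\<rho>\<^sup>2) ^ d) \<le> m * (2 * (real N + 1) * ln 2)"
    by (simp add: power_mult_distrib power2_eq_square mult_ac)
  then have "m * (\<rho>\<^sup>2) ^ d \<le> 2 * (real N + 1) * ln 2" using m by simp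
  also have "\<dots> \<le> 2 * (real N + 1) * 1" using ln_le_minus_one[of "2::real"] by (intro mult_left_mono) auto
  also have "\<dots> \<le> 4 * real N" using d by simp
  finally have 1: "m * (\<rho>\<^sup>2) ^ d \<le> 4 * real N" .
  have "(real N - real d) ^ d * (\<rho>\<^sup>2) ^ d \<le> (m * fact d) * (\<rho>\<^sup>2) ^ d"
    using power_le_binomial_times_fact[of d N] d by (intro mult_right_mono) (auto simp: m_def)
  also have "\<dots> = (m * (\<rho>\<^sup>2) ^ d) * fact d" by simp
  also have "\<dots> \<le> (4 * real N) * (real d ^ (d + 1) * exp (1 - real d))"
    by (rule mult_mono[OF 1 fact_le_stirling[OF d(1)]]) auto
  finally show ?thesis using d by (simp add: le_divide_eq mult.commute)
qed

text \<open>
  The bound obtained from degree \<open>d = \<lceil>ln N\<rceil>\<close> by taking \<open>d\<close>-th roots and using \<open>ln N \<le> d \<le> ln N + 1\<close>.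
\<close>

definition radius_majorant :: "nat \<Rightarrow> real" where
  "radius_majorant N = sqrt (N / ln N) * sqrt (exp ((ln 4 + 1 + ln (ln N + 1)) / ln N) * ((ln N + 1) / (N - ln N - 1)))"

lemma radius_majorant_tendsto: "radius_majorant \<longlonglongrightarrow> 1"
  unfolding radius_majorant_def by real_asymp

lemma eventually_bohr_radius_le:
  "eventually (\<lambda>N. \<forall>\<rho>\<in>bohr_radii N (homogeneous_functions N). sqrt (N / ln N) * \<rho> \<le> radius_majorant N) sequentially"
proof -
  have "eventually (\<lambda>N::nat. 1 \<le> ln N) sequentially" "eventually (\<lambda>N::nat. ln N + 1 < N) sequentially"
    by real_asymp+
  then show ?thesis
  proof eventually_elim
    case (elim N)
    define L where "L = ln (real N)"
    have L: "1 \<le> L" "L + 1 < N" using elim by (simp_all add: L_def)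
    \<comment> \<open>Since \<open>ln N \<le> d\<close>, the \<open>d\<close>-th root of the factor \<open>N\<close> in the bound is at most \<open>exp 1\<close>.\<close>
    define d where "d = nat \<lceil>L\<rceil>"
    have dL: "L \<le> d" "d \<le> L + 1" using L unfolding d_def by linarith+
    then have d: "1 \<le> d" "d < N" using L by linarith+
    define U where "U = exp ((ln 4 + 1 + ln (L + 1)) / L) * ((L + 1) / (N - L - 1))"
    have U: "U > 0" using L by (simp add: U_def)
    show ?case
    proof
      fix \<rho> assume \<rho>: "\<rho> \<in> bohr_radii N (homogeneous_functions N)"
      then have \<rho>0: "\<rho> \<ge> 0" by (simp add: bohr_radii_def)
      have "(\<rho>\<^sup>2) ^ d \<le> 4 * real N * (real d ^ (d + 1) * exp (1 - real d)) / (real N - real d) ^ d"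
        by (rule bohr_radius_power_le[OF d \<rho>])
      also have "\<dots> = exp (ln 4 + L + real (d + 1) * ln d + (1 - real d) - real d * ln (real N - real d))"
        using d unfolding L_def exp_add exp_diff exp_of_nat_mult by (simp add: mult_ac)
      also have "\<dots> \<le> exp (real d * ((ln 4 + 1 + ln (L + 1)) / L + (ln (L + 1) - ln (real N - L - 1))))"
      proof -
        have l1: "ln (real d) \<le> ln (L + 1)" using d dL by simp
        have l2: "ln (real N - L - 1) \<le> ln (real N - real d)" using L dL d by simp
        have c0: "0 \<le> ln 4 + 1 + ln (L + 1)" using L by (simp add: add_nonneg_nonneg)
        have "ln 4 + 1 + ln (real d) \<le> (ln 4 + 1 + ln (L + 1))" using l1 by simp
        also have "\<dots> \<le> real d / L * (ln 4 + 1 + ln (L + 1))"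
          using dL L c0 mult_right_mono[of 1 "real d / L", OF _ c0] by simp
        finally have "ln 4 + 1 + ln (real d) \<le> real d * ((ln 4 + 1 + ln (L + 1)) / L)" by simp
        moreover have "real d * (ln d - ln (real N - real d)) \<le> real d * (ln (L + 1) - ln (real N - L - 1))"
          using l1 l2 by (intro mult_left_mono) auto
        moreover have "ln 4 + L + real (d + 1) * ln d + (1 - real d) - real d * ln (real N - real d)
            \<le> (ln 4 + 1 + ln d) + real d * (ln d - ln (real N - real d))"
          using dL by (simp add: algebra_simps)
        ultimately show ?thesis by (simp add: distrib_left)
      qed
      also have "\<dots> = U ^ d"
        using L unfolding exp_of_nat_mult U_def exp_add exp_diff by simp
      finally have "\<rho>\<^sup>2 \<le> U" using U d by (subst (asm) power_mono_iff) auto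
      then have "\<rho> \<le> sqrt U" by (rule real_le_rsqrt)
      then have "sqrt (N / ln N) * \<rho> \<le> sqrt (N / ln N) * sqrt U"
        using L by (intro mult_left_mono) (auto simp: L_def)
      then show "sqrt (N / ln N) * \<rho> \<le> radius_majorant N"
        by (simp add: radius_majorant_def U_def L_def)
    qed
  qed
qed

section \<open>The lower bound for the radius\<close>

text \<open>
  The order \<open>k\<close> is fixed in terms of \<open>\<eta>\<close> such that the loss \<open>3 powr (d / k)\<close> uses up half of the slack
  \<open>exp (\<eta> * d)\<close>. Constant functions have degree \<open>0\<close> and are treated directly.
\<close>

lemma eventually_mem_bohr_radii:
  assumes \<eta>: "\<eta> > 0"
  shows "eventually (\<lambda>N::nat. exp (- \<eta>) / sqrt (N / ln N) \<in> bohr_radii N (homogeneous_functions N)) sequentially"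
proof -
  define k where "k = nat \<lceil>2 * ln 3 / \<eta>\<rceil>"
  have "2 * ln 3 / \<eta> > 0" using \<eta> by simp
  then have k: "1 \<le> k" "2 * ln 3 / \<eta> \<le> k" unfolding k_def by linarith+
  then have k2: "ln 3 / real k \<le> \<eta> / 2" using \<eta> by (simp add: field_simps)
  define C where "C = 36 * 18 ^ k * sqrt (real k) * real k ^ 3"
  have C: "C > 0" using k by (simp add: C_def)
  have "eventually (\<lambda>N::nat. 1 \<le> ln N) sequentially" by real_asymp
  with eventually_homogeneous_estimate[OF C \<eta> k(1) k2] show ?thesis
  proof eventually_elim
    case (elim N)
    let ?V = "{1..N}"
    define R where "R = exp \<eta> * sqrt (N / ln N)"
    have R: "R > 0" unfolding R_def using sqrt_ratio_pos[OF elim(2)] by (rule mult_pos_pos[OF exp_gt_zero])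
    have radius: "exp (- \<eta>) / sqrt (N / ln N) = 1 / R" by (simp add: R_def exp_minus field_simps)
    have "(\<Sum>S\<in>Pow ?V. \<bar>fourier_coeff N f S\<bar> * (1 / R) ^ card S) \<le> cube_sup_norm N f"
      if "f \<in> homogeneous_functions N" for f
    proof -
      define c where "c = fourier_coeff N f"
      have "\<exists>d\<le>N. \<forall>S. S \<subseteq> ?V \<longrightarrow> card S \<noteq> d \<longrightarrow> c S = 0"
        using that by (simp add: homogeneous_functions_def d_homogeneous_def c_def)
      then obtain d where dN: "d \<le> N" and hom: "\<And>S. S \<subseteq> ?V \<Longrightarrow> card S \<noteq> d \<Longrightarrow> c S = 0"
        by blast
      define A where "A = cube_sup_norm N f"
      have fc: "walsh_sum ?V c x = f x" if "x \<in> signs ?V" for x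
        using fourier_inversion[OF _ that, of f] by (simp add: c_def fourier_coeff_eq_avg[abs_def])
      have bound: "\<bar>walsh_sum ?V c x\<bar> \<le> A" if "x \<in> signs ?V" for x
        using fc[OF that] le_cube_sup_norm[OF that, of f] by (simp add: A_def)
      obtain x0 where x0: "x0 \<in> signs ?V" using cube_nonempty[of N] unfolding cube_eq_signs by blast
      then have A: "A \<ge> 0" using bound by force
      have "(\<Sum>S\<in>Pow ?V. \<bar>c S\<bar>) \<le> R ^ d * A"
      proof (cases "d = 0")
        case True
        have card0: "card S = 0 \<longleftrightarrow> S = {}" if "S \<subseteq> ?V" for S
          using finite_subset[OF that] by simp
        have "(\<Sum>S\<in>Pow ?V. \<bar>c S\<bar>) = (\<Sum>S\<in>{{}}. \<bar>c S\<bar>)"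
          using hom True card0 by (intro sum.mono_neutral_right) auto
        also have "\<dots> = \<bar>walsh_sum ?V c x0\<bar>"
        proof -
          have "walsh_sum ?V c x0 = (\<Sum>S\<in>{{}}. c S * walsh S x0)"
            unfolding walsh_sum_def using hom True card0 by (intro sum.mono_neutral_right) auto
          then show ?thesis by (simp add: walsh_def)
        qed
        finally show ?thesis using bound[OF x0] True by simp
      next
        case False
        have "(\<Sum>S\<in>Pow ?V. \<bar>c S\<bar>) \<le> C * real d ^ (4 * k) * 3 powr (real d / real k)
            * exp ((real d + real d * ln N - real d * ln d - ln N) / 2) * A"
          using homogeneous_coefficient_sum_le[OF _ k(1) _ _ hom bound] False dN by (simp add: C_def)
        also have "\<dots> \<le> R ^ d * A"
          using elim(1) False A unfolding R_def by (intro mult_right_mono) auto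
        finally show ?thesis .
      qed
      moreover have "(\<Sum>S\<in>Pow ?V. \<bar>c S\<bar> * (1 / R) ^ card S) = (\<Sum>S\<in>Pow ?V. \<bar>c S\<bar>) / R ^ d"
        unfolding sum_divide_distrib
      proof (rule sum.cong[OF refl])
        fix S assume "S \<in> Pow ?V"
        then show "\<bar>c S\<bar> * (1 / R) ^ card S = \<bar>c S\<bar> / R ^ d"
          using hom[of S] by (cases "card S = d") (auto simp: power_divide)
      qed
      ultimately show ?thesis using R by (simp add: A_def c_def divide_le_eq mult.commute)
    qed
    then show ?case unfolding radius bohr_radii_def using R by simp
  qed
qed

section \<open>The limit\<close>

lemma boolean_radius_eq: "boolean_radius N F = Sup (ereal ` bohr_radii N F)"
  by (simp add: boolean_radius_def bohr_radii_def)

lemma ereal_mult_divide_cancel: "0 < s \<Longrightarrow> ereal s * ereal (t / s) = ereal t"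
  by simp

theorem corollary3p2:
  shows "(\<lambda>N::nat. ereal (sqrt (real N / ln (real N))) *
            boolean_radius N (homogeneous_functions N)) \<longlonglongrightarrow> 1"
proof (rule order_tendstoI)
  fix a :: ereal assume a: "a < 1"
  have "((\<lambda>\<eta>. ereal (exp (- \<eta>))) \<longlongrightarrow> ereal (exp (- 0))) (at_right 0)"
    by (intro tendsto_intros)
  then have "eventually (\<lambda>\<eta>. a < ereal (exp (- \<eta>))) (at_right (0::real))"
    using a by (intro order_tendstoD(1)) (auto simp: one_ereal_def)
  moreover have "eventually (\<lambda>\<eta>::real. \<eta> > 0) (at_right 0)" by (rule eventually_at_right_less)
  ultimately have "eventually (\<lambda>\<eta>. \<eta> > 0 \<and> a < ereal (exp (- \<eta>))) (at_right (0::real))"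
    by eventually_elim simp
  then obtain \<eta> :: real where \<eta>: "\<eta> > 0" "a < ereal (exp (- \<eta>))"
    using eventually_happens'[OF trivial_limit_at_right_real] by blast
  have "eventually (\<lambda>N::nat. 1 \<le> ln N) sequentially" by real_asymp
  with eventually_mem_bohr_radii[OF \<eta>(1)]
  show "eventually (\<lambda>N::nat. a < ereal (sqrt (N / ln N)) * boolean_radius N (homogeneous_functions N)) sequentially"
  proof eventually_elim
    case (elim N)
    have s: "sqrt (N / ln N) > 0" using sqrt_ratio_pos[OF elim(2)] .
    have "ereal (exp (- \<eta>) / sqrt (N / ln N)) \<le> boolean_radius N (homogeneous_functions N)"
      unfolding boolean_radius_eq using elim(1) by (intro Sup_upper) simp
    then have "ereal (sqrt (N / ln N)) * ereal (exp (- \<eta>) / sqrt (N / ln N))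
        \<le> ereal (sqrt (N / ln N)) * boolean_radius N (homogeneous_functions N)"
      using s by (intro ereal_mult_left_mono) auto
    then show ?case using \<eta>(2) unfolding ereal_mult_divide_cancel[OF s] by (rule less_le_trans[rotated])
  qed
next
  fix a :: ereal assume a: "1 < a"
  have "eventually (\<lambda>N. ereal (radius_majorant N) < a) sequentially"
    using radius_majorant_tendsto a by (intro order_tendstoD(2)[of _ "ereal 1"]) (auto simp: one_ereal_def)
  moreover have "eventually (\<lambda>N::nat. 1 \<le> ln N) sequentially" by real_asymp
  ultimately show "eventually (\<lambda>N::nat. ereal (sqrt (N / ln N)) * boolean_radius N (homogeneous_functions N) < a) sequentially"
    using eventually_bohr_radius_le
  proof eventually_elim
    case (elim N)
    have s: "sqrt (N / ln N) > 0" using sqrt_ratio_pos[OF elim(2)] .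
    have "boolean_radius N (homogeneous_functions N) \<le> ereal (radius_majorant N / sqrt (N / ln N))"
      unfolding boolean_radius_eq
    proof (rule Sup_least)
      fix z assume "z \<in> ereal ` bohr_radii N (homogeneous_functions N)"
      then show "z \<le> ereal (radius_majorant N / sqrt (N / ln N))"
        using elim(3) s by (auto simp: pos_le_divide_eq mult.commute)
    qed
    then have "ereal (sqrt (N / ln N)) * boolean_radius N (homogeneous_functions N)
        \<le> ereal (sqrt (N / ln N)) * ereal (radius_majorant N / sqrt (N / ln N))"
      using s by (intro ereal_mult_left_mono) auto
    also have "\<dots> = ereal (radius_majorant N)" by (rule ereal_mult_divide_cancel[OF s])
    finally show ?case using elim(1) by (rule le_less_trans)
  qed
qed

end
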